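(* For $0<r<\frac12$ there is a homotopy equivalence $$\check{\mathbf C}_{<}(S^1;r)\simeq S^{2l+1}\quad\text{for } \tfrac{l}{2(l+1)}<r\le\tfrac{l+1}{2(l+2)},\ l=0,1,\ldots.$$ Moreover, if $\frac{l}{2(l+1)}<r\le r'\le\frac{l+1}{2(l+2)}$, then the inclusion $\check{\mathbf C}_{<}(S^1;r)\hookrightarrow\check{\mathbf C}_{<}(S^1;r')$ is a homotopy equivalence.
   Context: $S^1$ denotes the circle of circumference $1$ with the arc-length metric. For $X\subseteq S^1$ and $r>0$, the Čech complex $\check{\mathbf C}_{<}(X;r)$ is the simplicial complex with vertex set $X$ in which a finite subset $\sigma\subseteq X$ is a face if and only if $\bigcap_{x\in\sigma}B_{<}(x;r)\neq\emptyset$, where $B_{<}(x;r)$ is the open ball of radius $r$ about $x$ in $S^1$; equivalently, $\sigma$ is contained in some open arc of length $2r$. The geometric realization carries the CW (weak) topology with respect to finite subcomplexes. *)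

theory Defs
  imports "HOL-Analysis.Analysis"
begin

text \<open>The circle S^1 of circumference 1, modelled as the half-open interval [0,1)
  with the arc-length metric (distance to the nearest integer of x - y).\<close>

definition circle :: "real set" where
  "circle = {0..<1}"

definition circle_dist :: "real \<Rightarrow> real \<Rightarrow> real" where
  "circle_dist x y = min (frac (x - y)) (frac (y - x))"

definition circle_ball :: "real \<Rightarrow> real \<Rightarrow> real set" where
  "circle_ball x r = {z \<in> circle. circle_dist x z < r}"

definition cech_complex :: "real set \<Rightarrow> real \<Rightarrow> real set set" where
  "cech_complex X r =
     {\<sigma>. \<sigma> \<subseteq> X \<and> finite \<sigma> \<and> (\<Inter>x\<in>\<sigma>. circle_ball x r) \<inter> circle \<noteq> {}}"

text \<open>Closed geometric simplex on a finite vertex set, as barycentric coordinate functions.\<close>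
definition geom_simplex :: "'a set \<Rightarrow> ('a \<Rightarrow> real) set" where
  "geom_simplex \<sigma> = {f. (\<forall>v. 0 \<le> f v) \<and> (\<forall>v. v \<notin> \<sigma> \<longrightarrow> f v = 0) \<and> sum f \<sigma> = 1}"

definition realization_set :: "'a set set \<Rightarrow> ('a \<Rightarrow> real) set" where
  "realization_set K = (\<Union>\<sigma>\<in>{\<sigma>\<in>K. finite \<sigma>}. geom_simplex \<sigma>)"

text \<open>Geometric realization with the weak (CW) topology with respect to finite
  subcomplexes: a set is open iff its trace on every closed simplex is open there,
  each closed simplex carrying its Euclidean topology.\<close>
definition realization :: "'a set set \<Rightarrow> ('a \<Rightarrow> real) topology" where
  "realization K = topology (\<lambda>U. U \<subseteq> realization_set K \<and>
     (\<forall>\<sigma>\<in>K. finite \<sigma> \<longrightarrow>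
        openin (subtopology (powertop_real UNIV) (geom_simplex \<sigma>)) (U \<inter> geom_simplex \<sigma>)))"

definition homotopy_equivalence_map :: "'a topology \<Rightarrow> 'b topology \<Rightarrow> ('a \<Rightarrow> 'b) \<Rightarrow> bool" where
  "homotopy_equivalence_map X Y f \<longleftrightarrow> continuous_map X Y f \<and>
     (\<exists>g. continuous_map Y X g \<and>
          homotopic_with (\<lambda>x. True) X X (g \<circ> f) id \<and>
          homotopic_with (\<lambda>x. True) Y Y (f \<circ> g) id)"

end

theory Submission
  imports Defs
begin

text \<open>Put $n = l + 1$ and $s = 1 - 2r$, so $1/(n+1) \le s < 1/n$. A finite set is a face of the
  complex at scale $r$ iff it leaves a gap longer than $s$ on the circle; such a set has at most $n$
  gaps of this kind, so after filling its short gaps it becomes a union of at most $n$ arcs.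
  Let $T$ be the complex of finite sets covered by $n$ closed arcs of a small length $\epsilon$. The full
  subcomplex of $T$ on a sufficiently dense finite subset of at most $n$ arcs is contractible, because
  the first point of an arc is dominated by the next one. Extending maps skeleton by skeleton over
  these contractible carriers gives a retraction onto the realization of $T$ that is homotopic to the
  identity by straight lines. The same argument compares $T$ with the complex of finite sets that
  miss one of $2n+1$ equal half-open cells of the circle, and rounding to the cell endpoints compares
  the latter with the boundary of a $2n$-simplex, a sphere of dimension $2n-1 = 2l+1$.
  As $T$ does not depend on $r$, the inclusions follow from the two-out-of-three property.\<close>

section \<open>Realizations with the weak topology\<close>

text \<open>The interval for r says exactly that n s < 1 and 1 \<le> (n + 1) s. The second
  inequality bounds the number of gaps longer than s by n. The strict first one leaves room for
  \<epsilon>: n arcs of length \<epsilon> with n (s + \<epsilon>) < 1 leave a gap longer than s, so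
  T lies inside the complex at scale r, and with the same \<epsilon> at every larger scale. The
  complexes are uncountable and not locally finite, so vertices cannot be removed from them one at a
  time. Every comparison is therefore an inclusion of L into K with a carrier: a face \<sigma> of K
  is enlarged to a finite face V \<sigma>, and only the finite full subcomplex of L on V \<sigma>
  has to be contracted. The carrier must be monotone in \<sigma>, so the added points come from a
  grid fixed in advance. The number 2n+1 is tight from both sides. Arcs shorter than a cell meet at
  most two cells each, so n of them miss a cell. Conversely, the runs of occupied cells are no more
  numerous than the occupied cells, nor than the empty ones, hence there are at most n of them,
  enough for T to be contractible on the carrier.\<close>

abbreviation simplex_topology :: "'a set \<Rightarrow> ('a \<Rightarrow> real) topology" where
  "simplex_topology \<sigma> \<equiv> subtopology (powertop_real UNIV) (geom_simplex \<sigma>)"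

lemma powertop_real_eq_euclidean: "powertop_real UNIV = (euclidean :: ('a \<Rightarrow> real) topology)"
  by (simp add: euclidean_product_topology)

lemma istopology_realization:
  "istopology (\<lambda>U. U \<subseteq> realization_set K \<and>
     (\<forall>\<sigma>\<in>K. finite \<sigma> \<longrightarrow> openin (simplex_topology \<sigma>) (U \<inter> geom_simplex \<sigma>)))"
  unfolding istopology_def
proof (intro conjI allI impI; (elim conjE)?)
  fix S T
  assume "\<forall>\<sigma>\<in>K. finite \<sigma> \<longrightarrow> openin (simplex_topology \<sigma>) (S \<inter> geom_simplex \<sigma>)"
    and "\<forall>\<sigma>\<in>K. finite \<sigma> \<longrightarrow> openin (simplex_topology \<sigma>) (T \<inter> geom_simplex \<sigma>)"
  moreover have "S \<inter> T \<inter> geom_simplex \<sigma> = (S \<inter> geom_simplex \<sigma>) \<inter> (T \<inter> geom_simplex \<sigma>)" for \<sigma>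
    by auto
  ultimately show "\<forall>\<sigma>\<in>K. finite \<sigma> \<longrightarrow> openin (simplex_topology \<sigma>) (S \<inter> T \<inter> geom_simplex \<sigma>)"
    by (metis openin_Int)
next
  fix \<K>
  assume *: "\<forall>S\<in>\<K>. S \<subseteq> realization_set K \<and>
    (\<forall>\<sigma>\<in>K. finite \<sigma> \<longrightarrow> openin (simplex_topology \<sigma>) (S \<inter> geom_simplex \<sigma>))"
  show "\<forall>\<sigma>\<in>K. finite \<sigma> \<longrightarrow> openin (simplex_topology \<sigma>) (\<Union>\<K> \<inter> geom_simplex \<sigma>)"
  proof (intro ballI impI)
    fix \<sigma> assume "\<sigma> \<in> K" "finite \<sigma>"
    then have "openin (simplex_topology \<sigma>) (\<Union>S\<in>\<K>. S \<inter> geom_simplex \<sigma>)"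
      using * by (intro openin_Union) auto
    then show "openin (simplex_topology \<sigma>) (\<Union>\<K> \<inter> geom_simplex \<sigma>)"
      by (simp add: Int_commute Int_UN_distrib Int_Union)
  qed
qed auto

lemma openin_realization:
  "openin (realization K) U \<longleftrightarrow> U \<subseteq> realization_set K \<and>
     (\<forall>\<sigma>\<in>K. finite \<sigma> \<longrightarrow> openin (simplex_topology \<sigma>) (U \<inter> geom_simplex \<sigma>))"
  unfolding realization_def by (simp add: topology_inverse'[OF istopology_realization])

lemma geom_simplex_subset_realization: "\<sigma> \<in> K \<Longrightarrow> finite \<sigma> \<Longrightarrow> geom_simplex \<sigma> \<subseteq> realization_set K"
  by (auto simp: realization_set_def)

lemma topspace_realization [simp]: "topspace (realization K) = realization_set K"
proof
  show "topspace (realization K) \<subseteq> realization_set K"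
    using openin_realization openin_topspace by blast
  have "openin (simplex_topology \<sigma>) (realization_set K \<inter> geom_simplex \<sigma>)"
    if "\<sigma> \<in> K" "finite \<sigma>" for \<sigma>
    using geom_simplex_subset_realization[OF that]
    by (simp add: Int_absorb1 openin_subtopology_refl)
  then have "openin (realization K) (realization_set K)"
    by (simp add: openin_realization)
  then show "realization_set K \<subseteq> topspace (realization K)"
    by (rule openin_subset)
qed

lemma continuous_map_from_realization:
  assumes "\<And>\<sigma>. \<sigma> \<in> K \<Longrightarrow> finite \<sigma> \<Longrightarrow> continuous_map (simplex_topology \<sigma>) Y f"
  shows "continuous_map (realization K) Y f"
  unfolding continuous_map topspace_realization openin_realization
proof (intro conjI allI impI ballI)
  show "f ` realization_set K \<subseteq> topspace Y"
    using assms unfolding continuous_map realization_set_def by fastforce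
  fix U \<sigma> assume U: "openin Y U" and \<sigma>: "\<sigma> \<in> K" "finite \<sigma>"
  have "{x \<in> realization_set K. f x \<in> U} \<inter> geom_simplex \<sigma> = {x \<in> geom_simplex \<sigma>. f x \<in> U}"
    using geom_simplex_subset_realization[OF \<sigma>] by auto
  then show "openin (simplex_topology \<sigma>) ({x \<in> realization_set K. f x \<in> U} \<inter> geom_simplex \<sigma>)"
    using assms[OF \<sigma>] U unfolding continuous_map by simp
qed auto

lemma continuous_map_into_realization:
  assumes "continuous_map X (simplex_topology \<sigma>) f" "\<sigma> \<in> K" "finite \<sigma>"
  shows "continuous_map X (realization K) f"
proof -
  have "continuous_map (simplex_topology \<sigma>) (realization K) id"
    unfolding continuous_map topspace_realization
  proof (intro conjI allI impI)
    show "id ` topspace (simplex_topology \<sigma>) \<subseteq> realization_set K"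
      using geom_simplex_subset_realization[OF assms(2,3)] by simp
    fix U assume "openin (realization K) U"
    moreover have "{x \<in> topspace (simplex_topology \<sigma>). id x \<in> U} = U \<inter> geom_simplex \<sigma>"
      by auto
    ultimately show "openin (simplex_topology \<sigma>) {x \<in> topspace (simplex_topology \<sigma>). id x \<in> U}"
      using assms(2,3) by (simp add: openin_realization)
  qed
  with assms(1) show ?thesis
    using continuous_map_compose by fastforce
qed

lemma continuous_map_realization_powertop: "continuous_map (realization K) (powertop_real UNIV) id"
  by (intro continuous_map_from_realization continuous_map_from_subtopology continuous_map_id)

lemma continuous_map_realization_mono:
  assumes "L \<subseteq> K"
  shows "continuous_map (realization L) (realization K) id"
  by (rule continuous_map_from_realization, rule continuous_map_into_realization)
     (use assms in auto)

text \<open>The interval is locally compact, so the product with it is again a weak topology.\<close>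
lemma continuous_map_from_interval_times_realization:
  fixes h :: "real \<times> ('a \<Rightarrow> real) \<Rightarrow> 'b"
  assumes h: "\<And>\<sigma>. \<sigma> \<in> K \<Longrightarrow> finite \<sigma> \<Longrightarrow>
      continuous_map (prod_topology (top_of_set {0..1}) (simplex_topology \<sigma>)) Y h"
  shows "continuous_map (prod_topology (top_of_set {0..1}) (realization K)) Y h"
  unfolding continuous_map
proof (intro conjI allI impI)
  let ?I = "top_of_set {0..1::real}"
  show "h ` topspace (prod_topology ?I (realization K)) \<subseteq> topspace Y"
  proof clarsimp
    fix t :: real and x :: "'a \<Rightarrow> real"
    assume t: "0 \<le> t" "t \<le> 1" and "x \<in> realization_set K"
    then obtain \<sigma> where "\<sigma> \<in> K" "finite \<sigma>" "x \<in> geom_simplex \<sigma>"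
      by (auto simp: realization_set_def)
    with h[of \<sigma>] t show "h (t, x) \<in> topspace Y"
      unfolding continuous_map by fastforce
  qed
  fix U assume U: "openin Y U"
  let ?P = "{p \<in> topspace (prod_topology ?I (realization K)). h p \<in> U}"
  show "openin (prod_topology ?I (realization K)) ?P"
    unfolding openin_prod_topology_alt
  proof (intro allI impI)
    fix t x assume "(t, x) \<in> ?P"
    then have t: "t \<in> {0..1}" and x: "x \<in> realization_set K" and hU: "h (t, x) \<in> U"
      by auto
    obtain \<sigma>0 where \<sigma>0: "\<sigma>0 \<in> K" "finite \<sigma>0" "x \<in> geom_simplex \<sigma>0"
      using x by (auto simp: realization_set_def)
    have "continuous_map ?I (prod_topology ?I (simplex_topology \<sigma>0)) (\<lambda>u. (u, x))"
      using \<sigma>0 by (intro continuous_map_pairedI) auto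
    from continuous_map_compose[OF this h[OF \<sigma>0(1,2)]]
    have "openin ?I {u \<in> {0..1}. h (u, x) \<in> U}"
      using U unfolding continuous_map by (auto simp: o_def)
    then obtain e where e: "e > 0" "\<And>u. u \<in> {0..1} \<Longrightarrow> dist u t < e \<Longrightarrow> h (u, x) \<in> U"
      using t hU unfolding openin_euclidean_subtopology_iff by auto
    \<comment> \<open>A compact interval around \<open>t\<close> is needed for the tube lemma: the
      points \<open>y\<close> whose whole slice over \<open>J\<close> is sent into \<open>U\<close>
      then form an open set \<open>B\<close>, checked on one closed simplex at a time.
      \<open>A\<close> is an open neighbourhood of \<open>t\<close> inside \<open>J\<close>.\<close>
    define J where "J = cball t (e/2) \<inter> {0..1}"
    define A where "A = {0..1} \<inter> ball t (e/2)"
    define B where "B = {y \<in> realization_set K. \<forall>u\<in>J. h (u, y) \<in> U}"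
    have "compact J" unfolding J_def by auto
    then have J: "compactin ?I J"
      by (simp add: compactin_subtopology J_def)
    have "openin (realization K) B"
      unfolding openin_realization
    proof (intro conjI ballI impI)
      show "B \<subseteq> realization_set K" by (auto simp: B_def)
      fix \<sigma> assume \<sigma>: "\<sigma> \<in> K" "finite \<sigma>"
      let ?W = "{p \<in> topspace (prod_topology ?I (simplex_topology \<sigma>)). h p \<in> U}"
      have W: "openin (prod_topology ?I (simplex_topology \<sigma>)) ?W"
        using h[OF \<sigma>] U unfolding continuous_map by blast
      show "openin (simplex_topology \<sigma>) (B \<inter> geom_simplex \<sigma>)"
      proof (subst openin_subopen, rule ballI)
        fix y assume y: "y \<in> B \<inter> geom_simplex \<sigma>"
        then have yW: "J \<times> {y} \<subseteq> ?W" by (auto simp: B_def J_def)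
        have y': "y \<in> topspace (simplex_topology \<sigma>)" using y by simp
        obtain Q R where QR:
          "openin (simplex_topology \<sigma>) R" "J \<subseteq> Q" "y \<in> R" "Q \<times> R \<subseteq> ?W"
          using tube_lemma_left[OF W J y' yW] by (elim exE conjE) (rule that)
        have "R \<subseteq> geom_simplex \<sigma>" using openin_subset[OF QR(1)] by simp
        then have "R \<subseteq> B \<inter> geom_simplex \<sigma>"
          using geom_simplex_subset_realization[OF \<sigma>] QR(2,4) unfolding B_def by blast
        with QR show "\<exists>T. openin (simplex_topology \<sigma>) T \<and> y \<in> T \<and> T \<subseteq> B \<inter> geom_simplex \<sigma>"
          by blast
      qed
    qed
    moreover have "openin ?I A" unfolding A_def by blast
    moreover have "t \<in> A" "A \<subseteq> J" using t e by (auto simp: A_def J_def)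
    moreover have "x \<in> B" using e x by (auto simp: B_def J_def dist_commute)
    moreover have "A \<times> B \<subseteq> ?P" using \<open>A \<subseteq> J\<close> by (auto simp: B_def A_def)
    ultimately show "\<exists>A B. openin ?I A \<and> openin (realization K) B \<and> t \<in> A \<and> x \<in> B \<and> A \<times> B \<subseteq> ?P"
      by blast
  qed
qed

text \<open>On each closed simplex the whole homotopy stays in one finite simplex \<open>W\<close>,
  where the topology is Euclidean and continuity can be checked by coordinates. This avoids any
  claim about addition in the weak topology.\<close>

lemma homotopic_realization_linear:
  fixes f g :: "('a \<Rightarrow> real) \<Rightarrow> 'b \<Rightarrow> real"
  assumes f: "continuous_map (realization K) (realization M) f"
    and g: "continuous_map (realization K) (realization M) g"
    and fg: "\<And>\<sigma>. \<sigma> \<in> K \<Longrightarrow> finite \<sigma> \<Longrightarrow>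
      \<exists>W\<in>M. finite W \<and> f ` geom_simplex \<sigma> \<subseteq> geom_simplex W \<and> g ` geom_simplex \<sigma> \<subseteq> geom_simplex W"
  shows "homotopic_with (\<lambda>x. True) (realization K) (realization M) f g"
proof -
  define h where "h = (\<lambda>(t::real, x) v. (1 - t) * f x v + t * g x v)"
  have "continuous_map (prod_topology (top_of_set {0..1}) (realization K)) (realization M) h"
  proof (rule continuous_map_from_interval_times_realization)
    fix \<sigma> assume \<sigma>: "\<sigma> \<in> K" "finite \<sigma>"
    then obtain W where W: "W \<in> M" "finite W" "f ` geom_simplex \<sigma> \<subseteq> geom_simplex W"
      "g ` geom_simplex \<sigma> \<subseteq> geom_simplex W"
      using fg by blast
    let ?X = "prod_topology (top_of_set {0..1::real}) (simplex_topology \<sigma>)"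
    \<comment> \<open>The weak topology is finer than the product topology, so coordinates of a map
      into a realization are continuous.\<close>
    have coord: "continuous_map ?X euclideanreal (\<lambda>p. k (snd p) v)"
      if k: "continuous_map (realization K) (realization M) k" for k v
    proof -
      have "continuous_map (simplex_topology \<sigma>) (powertop_real UNIV) (id \<circ> (k \<circ> id))"
        by (rule continuous_map_compose[OF continuous_map_compose[OF
              continuous_map_into_realization[OF continuous_map_id \<sigma>] k]
              continuous_map_realization_powertop])
      then have "continuous_map (simplex_topology \<sigma>) euclideanreal (\<lambda>x. k x v)"
        by (simp add: continuous_map_componentwise_UNIV)
      from continuous_map_compose[OF continuous_map_snd this] show ?thesis
        by (simp add: o_def)
    qed
    have t: "continuous_map ?X euclideanreal fst"
      using continuous_map_compose[OF continuous_map_fst[of "top_of_set {0..1::real}" "simplex_topology \<sigma>"],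
          of euclideanreal id] by (simp add: continuous_map_from_subtopology)
    have "continuous_map ?X (simplex_topology W) h"
      unfolding continuous_map_in_subtopology continuous_map_componentwise_UNIV
    proof (intro conjI allI)
      fix v
      show "continuous_map ?X euclideanreal (\<lambda>p. h p v)"
        unfolding h_def case_prod_unfold
        by (intro continuous_intros coord f g t)
      show "h \<in> topspace ?X \<rightarrow> geom_simplex W"
      proof clarsimp
        fix t :: real and x assume t: "0 \<le> t" "t \<le> 1" and "x \<in> geom_simplex \<sigma>"
        then have "f x \<in> geom_simplex W" "g x \<in> geom_simplex W"
          using W by auto
        with t show "h (t, x) \<in> geom_simplex W"
          by (auto simp: h_def geom_simplex_def sum.distrib sum_distrib_left[symmetric])
      qed
    qed
    then show "continuous_map ?X (realization M) h"
      by (rule continuous_map_into_realization[OF _ W(1,2)])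
  qed
  then show ?thesis
    unfolding homotopic_with_def by (intro exI[of _ h]) (auto simp: h_def)
qed

section \<open>Extension over simplices\<close>

text \<open>Both radial constructions, the extension over a simplex and the homeomorphism with the
  sphere, subtract the smallest coordinate to reach the boundary of a simplex.\<close>

lemma continuous_on_Min_coords:
  fixes S :: "('a \<Rightarrow> real) set"
  assumes "finite \<sigma>" "\<sigma> \<noteq> {}"
  shows "continuous_on S (\<lambda>x. Min (x ` \<sigma>))"
  using assms
proof (induction \<sigma> rule: finite_ne_induct)
  case (singleton v)
  have "continuous_on S (\<lambda>x. x v)"
    by (rule continuous_on_subset[OF continuous_on_product_coordinates]) auto
  then show ?case by simp
next
  case (insert v F)
  then have eq: "(\<lambda>x. Min (x ` insert v F)) = (\<lambda>x::'a \<Rightarrow> real. min (x v) (Min (x ` F)))"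
    by (auto simp: fun_eq_iff)
  have "continuous_on S (\<lambda>x. x v)"
    by (rule continuous_on_subset[OF continuous_on_product_coordinates]) auto
  then show ?case
    unfolding eq using insert.IH by (rule continuous_on_min)
qed

text \<open>A map on the boundary is extended along the rays from the barycentre, running through a
  contraction of the target.\<close>
lemma extend_from_simplex_boundary:
  fixes f :: "('a \<Rightarrow> real) \<Rightarrow> 'b"
  assumes \<sigma>: "finite \<sigma>" "\<sigma> \<noteq> {}" and X: "contractible_space X" "topspace X \<noteq> {}"
    and f: "continuous_map (subtopology (powertop_real UNIV) {x \<in> geom_simplex \<sigma>. \<exists>v\<in>\<sigma>. x v = 0}) X f"
  obtains F where "continuous_map (simplex_topology \<sigma>) X F"
    "\<And>x v. x \<in> geom_simplex \<sigma> \<Longrightarrow> v \<in> \<sigma> \<Longrightarrow> x v = 0 \<Longrightarrow> F x = f x"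
proof -
  let ?B = "{x \<in> geom_simplex \<sigma>. \<exists>v\<in>\<sigma>. x v = 0}"
  obtain a where a: "a \<in> topspace X" using X(2) by blast
  then have "homotopic_with (\<lambda>x. True) X X id (\<lambda>x. a)"
    using X(1) by (simp add: contractible_space_alt)
  then obtain h where h: "continuous_map (prod_topology (top_of_set {0..1::real}) X) X h"
    and h0: "\<And>x. h (0, x) = x" and h1: "\<And>x. h (1, x) = a"
    by (auto simp: homotopic_with_def)
  define k where "k = real (card \<sigma>)"
  have k: "k > 0" using \<sigma> by (simp add: k_def card_gt_0_iff)
  \<comment> \<open>Every point is \<open>t x\<close> times a boundary point \<open>y x\<close> plus
    \<open>1 - t x\<close> times the barycentre, where \<open>1 - t x\<close> is \<open>k\<close>
    times the smallest coordinate. So \<open>t\<close> is 0 at the barycentre and 1 on the boundary.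
    Since \<open>y\<close> is undefined at the barycentre, \<open>F\<close> is constant for
    \<open>t x \<le> 1/2\<close>; beyond that the contraction runs backwards, at time
    \<open>2 - 2 * t x\<close>, from the constant to \<open>f\<close> itself.\<close>
  define m where "m = (\<lambda>x::'a \<Rightarrow> real. Min (x ` \<sigma>))"
  define t where "t = (\<lambda>x. 1 - k * m x)"
  define y where "y = (\<lambda>x v. if v \<in> \<sigma> then (x v - m x) / t x else 0)"
  define F where "F = (\<lambda>x. if t x \<le> 1/2 then a else h (2 - 2 * t x, f (y x)))"
  have m_le: "m x \<le> x v" if "v \<in> \<sigma>" for x v
    using \<sigma> that by (simp add: m_def)
  have m_attained: "\<exists>v\<in>\<sigma>. x v = m x" for x
    using Min_in[of "x ` \<sigma>"] \<sigma> unfolding m_def by fastforce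
  have m_nonneg: "0 \<le> m x" if "x \<in> geom_simplex \<sigma>" for x
  proof -
    obtain v where "v \<in> \<sigma>" "x v = m x" using m_attained[of x] by blast
    moreover have "0 \<le> x v" using that by (simp add: geom_simplex_def)
    ultimately show ?thesis by simp
  qed
  then have t_le: "t x \<le> 1" if "x \<in> geom_simplex \<sigma>" for x
    using that k by (simp add: t_def)
  have cm: "continuous_on S m" for S
    unfolding m_def by (rule continuous_on_Min_coords[OF \<sigma>])
  have ct: "continuous_on S t" for S
    unfolding t_def by (intro continuous_intros cm)
  let ?D = "{x \<in> geom_simplex \<sigma>. 1/2 \<le> t x}"
  have y_mem: "y x \<in> ?B" if x: "x \<in> ?D" for x
  proof -
    have "sum x \<sigma> = 1" using x by (auto simp: geom_simplex_def)
    then have "(\<Sum>v\<in>\<sigma>. (x v - m x)) = t x"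
      by (simp add: sum_subtractf t_def k_def)
    then have "sum (y x) \<sigma> = 1"
      using x by (simp add: y_def sum_divide_distrib[symmetric])
    moreover have "\<exists>v\<in>\<sigma>. y x v = 0" using m_attained[of x] by (auto simp: y_def)
    ultimately show ?thesis using x m_le
      by (auto simp: geom_simplex_def y_def)
  qed
  have cy: "continuous_on ?D y"
  proof (rule continuous_on_coordinatewise_then_product)
    fix v
    show "continuous_on ?D (\<lambda>x. y x v)"
    proof (cases "v \<in> \<sigma>")
      case True
      have "continuous_on ?D (\<lambda>x. x v)"
        by (rule continuous_on_subset[OF continuous_on_product_coordinates]) auto
      then show ?thesis
        using True unfolding y_def by (auto intro!: continuous_intros cm ct)
    qed (simp add: y_def)
  qed
  have st: "simplex_topology \<sigma> = top_of_set (geom_simplex \<sigma>)"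
    by (simp add: powertop_real_eq_euclidean)
  have "continuous_map (top_of_set (geom_simplex \<sigma>)) X F"
    unfolding F_def
  proof (rule continuous_map_cases_le)
    show "continuous_map (top_of_set (geom_simplex \<sigma>)) euclideanreal t"
      using ct by simp
    have D: "subtopology (top_of_set (geom_simplex \<sigma>))
        {x \<in> topspace (top_of_set (geom_simplex \<sigma>)). 1 / 2 \<le> t x} = top_of_set ?D"
      by (simp add: subtopology_subtopology Int_def)
    have "continuous_map (top_of_set ?D) (top_of_set ?B) y"
      using cy y_mem by auto
    then have "continuous_map (top_of_set ?D) X (f \<circ> y)"
      using f continuous_map_compose unfolding powertop_real_eq_euclidean by blast
    moreover have "continuous_map (top_of_set ?D) (top_of_set {0..1}) (\<lambda>x. 2 - 2 * t x)"
      using t_le by (auto intro!: continuous_intros ct)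
    ultimately have "continuous_map (top_of_set ?D) (prod_topology (top_of_set {0..1}) X)
        (\<lambda>x. (2 - 2 * t x, f (y x)))"
      by (intro continuous_map_pairedI) (simp_all add: o_def)
    from continuous_map_compose[OF this h]
    show "continuous_map (subtopology (top_of_set (geom_simplex \<sigma>))
        {x \<in> topspace (top_of_set (geom_simplex \<sigma>)). 1 / 2 \<le> t x}) X
        (\<lambda>x. h (2 - 2 * t x, f (y x)))"
      by (simp only: D o_def)
    show "a = h (2 - 2 * t x, f (y x))" if "t x = 1/2" for x
      by (simp add: that h1)
  qed (use a in auto)
  moreover have "F x = f x" if x: "x \<in> geom_simplex \<sigma>" and v: "v \<in> \<sigma>" "x v = 0" for x v
  proof -
    have "m x = 0"
      using m_le[OF v(1), of x] m_nonneg[OF x] v by simp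
    then have "t x = 1" "y x = x"
      using x by (auto simp: t_def y_def geom_simplex_def fun_eq_iff)
    then show ?thesis by (simp add: F_def h0)
  qed
  ultimately show thesis using that[of F] by (simp add: st)
qed

section \<open>Abstract complexes, supports and boundaries of simplices\<close>

definition abstract_complex :: "'a set set \<Rightarrow> bool" where
  "abstract_complex K \<longleftrightarrow> (\<forall>\<sigma>\<in>K. finite \<sigma> \<and> Pow \<sigma> \<subseteq> K)"

lemma abstract_complexD:
  assumes "abstract_complex K" "\<sigma> \<in> K"
  shows "finite \<sigma>" "\<tau> \<subseteq> \<sigma> \<Longrightarrow> \<tau> \<in> K"
  using assms by (auto simp: abstract_complex_def)

definition full_subcomplex :: "'a set set \<Rightarrow> 'a set \<Rightarrow> 'a set set" where
  "full_subcomplex L W = {\<tau>\<in>L. \<tau> \<subseteq> W}"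

text \<open>The support of a point is the smallest face carrying it. Maps assembled simplex by
  simplex are later defined by looking it up, which makes them single-valued by
  construction.\<close>

lemma geom_simplex_support:
  assumes "x \<in> geom_simplex \<sigma>" "finite \<sigma>"
  shows "{v. x v \<noteq> 0} \<subseteq> \<sigma>" "{v. x v \<noteq> 0} \<noteq> {}" "x \<in> geom_simplex {v. x v \<noteq> 0}"
proof -
  show sub: "{v. x v \<noteq> 0} \<subseteq> \<sigma>" using assms by (auto simp: geom_simplex_def)
  have "sum x {v. x v \<noteq> 0} = sum x \<sigma>"
    by (rule sum.mono_neutral_left) (use assms sub in auto)
  then have "sum x {v. x v \<noteq> 0} = 1" using assms by (simp add: geom_simplex_def)
  then show "x \<in> geom_simplex {v. x v \<noteq> 0}" "{v. x v \<noteq> 0} \<noteq> {}"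
    using assms by (auto simp: geom_simplex_def simp del: Collect_empty_eq)
qed

lemma geom_simplex_mono:
  assumes "\<sigma> \<subseteq> \<tau>" "finite \<tau>"
  shows "geom_simplex \<sigma> \<subseteq> geom_simplex \<tau>"
proof
  fix x :: "'a \<Rightarrow> real" assume x: "x \<in> geom_simplex \<sigma>"
  then have "sum x \<sigma> = sum x \<tau>"
    by (intro sum.mono_neutral_left) (use assms in \<open>auto simp: geom_simplex_def\<close>)
  with x assms show "x \<in> geom_simplex \<tau>" by (auto simp: geom_simplex_def)
qed

lemma geom_simplex_empty [simp]: "geom_simplex {} = {}"
  by (auto simp: geom_simplex_def)

lemma geom_simplex_delete:
  assumes "finite \<sigma>" "v \<in> \<sigma>"
  shows "geom_simplex (\<sigma> - {v}) = {x \<in> geom_simplex \<sigma>. x v = 0}"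
proof -
  have "sum x (\<sigma> - {v}) = sum x \<sigma>" if "x v = 0" for x :: "'a \<Rightarrow> real"
    by (rule sum.mono_neutral_left) (use assms that in auto)
  then show ?thesis by (auto simp: geom_simplex_def) 
qed

lemma closedin_geom_simplex_face:
  "closedin (simplex_topology \<sigma>) {x \<in> geom_simplex \<sigma>. x v = 0}"
proof -
  have "continuous_on (geom_simplex \<sigma>) (\<lambda>x. x v)"
    by (rule continuous_on_subset[OF continuous_on_product_coordinates]) auto
  from continuous_closedin_preimage[OF this, of "{0}"] show ?thesis
    by (simp add: powertop_real_eq_euclidean vimage_def Int_def)
qed

text \<open>The boundary is the union of finitely many closed facets, so continuity on the facets
  pastes together.\<close>

lemma continuous_map_on_simplex_boundary:
  assumes \<sigma>: "finite \<sigma>"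
    and f: "\<And>v. v \<in> \<sigma> \<Longrightarrow> continuous_map (simplex_topology (\<sigma> - {v})) X f"
  shows "continuous_map (subtopology (powertop_real UNIV) {x \<in> geom_simplex \<sigma>. \<exists>v\<in>\<sigma>. x v = 0}) X f"
proof (rule pasting_lemma_closed[where I = \<sigma> and T = "\<lambda>v. geom_simplex (\<sigma> - {v})" and f = "\<lambda>v. f"])
  let ?B = "{x \<in> geom_simplex \<sigma>. \<exists>v\<in>\<sigma>. x v = 0}"
  fix v assume v: "v \<in> \<sigma>"
  have sub: "geom_simplex (\<sigma> - {v}) \<subseteq> ?B" "?B \<subseteq> geom_simplex \<sigma>"
    using v \<sigma> by (auto simp: geom_simplex_delete)
  show "closedin (subtopology (powertop_real UNIV) ?B) (geom_simplex (\<sigma> - {v}))"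
    using closedin_subset_topspace[OF closedin_geom_simplex_face[of \<sigma> v], of ?B] sub v \<sigma>
    by (simp add: geom_simplex_delete subtopology_subtopology Int_absorb1)
  show "continuous_map (subtopology (subtopology (powertop_real UNIV) ?B) (geom_simplex (\<sigma> - {v}))) X f"
    using f[OF v] sub by (simp add: subtopology_subtopology Int_absorb1)
qed (use \<sigma> in \<open>auto simp: geom_simplex_delete\<close>)

section \<open>Subcomplexes with contractible carriers\<close>

lemma realization_set_full_subcomplex_subset:
  assumes "finite W"
  shows "realization_set (full_subcomplex L W) \<subseteq> geom_simplex W"
  unfolding realization_set_def full_subcomplex_def by (rule UN_least) (simp add: geom_simplex_mono assms)

text \<open>A fibre lemma in the style of Quillen. When the retraction is extended over \<sigma>,
  \<open>V_mono\<close> guarantees that its values on the boundary of \<sigma> already lie over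
  \<open>V \<sigma>\<close>, and contractibility of that part of \<open>L\<close> fills in the
  interior. That \<open>V \<sigma>\<close> is a face of \<open>K\<close> containing \<sigma> puts a
  point and its image into a common simplex. An empty space counts as contractible, hence the
  separate assumption \<open>ne\<close>. The equivalence is given by \<open>id\<close>, so the
  result speaks about the inclusion and not merely about homotopy types.\<close>

proposition homotopy_equivalence_subcomplex:
  fixes K L :: "'a set set"
  assumes K: "abstract_complex K" and L: "abstract_complex L" and LK: "L \<subseteq> K"
    and V: "\<And>\<sigma>. \<sigma> \<in> K \<Longrightarrow> \<sigma> \<noteq> {} \<Longrightarrow> \<sigma> \<subseteq> V \<sigma> \<and> V \<sigma> \<in> K"
    and V_mono: "\<And>\<sigma> \<tau>. \<tau> \<in> K \<Longrightarrow> \<sigma> \<noteq> {} \<Longrightarrow> \<sigma> \<subseteq> \<tau> \<Longrightarrow> V \<sigma> \<subseteq> V \<tau>"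
    and contr: "\<And>\<sigma>. \<sigma> \<in> K \<Longrightarrow> \<sigma> \<noteq> {} \<Longrightarrow> contractible_space (realization (full_subcomplex L (V \<sigma>)))"
    and ne: "\<And>\<sigma>. \<sigma> \<in> K \<Longrightarrow> \<sigma> \<noteq> {} \<Longrightarrow> realization_set (full_subcomplex L (V \<sigma>)) \<noteq> {}"
  shows "homotopy_equivalence_map (realization L) (realization K) id"
proof -
  define R where "R \<sigma> = realization (full_subcomplex L (V \<sigma>))" for \<sigma>
  \<comment> \<open>After stage \<open>k\<close> the map is settled on the faces with at most
    \<open>k\<close> vertices and on all of \<open>L\<close>. Including \<open>L\<close> from the
    start forces the final map to fix it pointwise.\<close>
  define good where "good k \<sigma> \<longleftrightarrow> \<sigma> \<in> K \<and> \<sigma> \<noteq> {} \<and> (card \<sigma> \<le> k \<or> \<sigma> \<in> L)" for k \<sigma>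
  define P where "P k f \<longleftrightarrow> (\<forall>x\<in>realization_set L. f x = x) \<and>
      (\<forall>\<sigma>. good k \<sigma> \<longrightarrow> continuous_map (simplex_topology \<sigma>) (R \<sigma>) f)" for k f
  have R_mono: "continuous_map X (R \<sigma>) f \<Longrightarrow> continuous_map X (R \<tau>) f"
    if "\<tau> \<in> K" "\<sigma> \<noteq> {}" "\<sigma> \<subseteq> \<tau>" for X :: "('a \<Rightarrow> real) topology" and \<sigma> \<tau> f
  proof -
    have "full_subcomplex L (V \<sigma>) \<subseteq> full_subcomplex L (V \<tau>)"
      using V_mono[OF that] by (auto simp: full_subcomplex_def)
    from continuous_map_realization_mono[OF this]
    show "continuous_map X (R \<sigma>) f \<Longrightarrow> continuous_map X (R \<tau>) f"
      unfolding R_def using continuous_map_compose by fastforce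
  qed
  have fin: "finite \<sigma>" if "\<sigma> \<in> K" for \<sigma> using abstract_complexD(1)[OF K that] .
  have support: "{v. x v \<noteq> 0} \<in> K" "{v. x v \<noteq> 0} \<noteq> {}" "x \<in> geom_simplex {v. x v \<noteq> 0}"
      "{v. x v \<noteq> 0} \<subseteq> \<sigma>"
    if "x \<in> geom_simplex \<sigma>" "\<sigma> \<in> K" for x \<sigma>
    using geom_simplex_support[OF that(1) fin[OF that(2)]] abstract_complexD(2)[OF K that(2)] by auto
  have "P 0 id"
    unfolding P_def
  proof (intro conjI allI impI)
    fix \<sigma> assume "good 0 \<sigma>"
    then have \<sigma>: "\<sigma> \<in> K" "\<sigma> \<noteq> {}" "\<sigma> \<in> L" using fin by (auto simp: good_def)
    then have "\<sigma> \<in> full_subcomplex L (V \<sigma>)" using V by (auto simp: full_subcomplex_def)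
    then show "continuous_map (simplex_topology \<sigma>) (R \<sigma>) id"
      unfolding R_def using continuous_map_into_realization[OF continuous_map_id] fin \<sigma> by blast
  qed auto
  have step: "\<exists>f'. P (Suc k) f' \<and> (\<forall>\<sigma>. good k \<sigma> \<longrightarrow> (\<forall>x\<in>geom_simplex \<sigma>. f' x = f x))"
    if f: "P k f" for k f
  proof -
    define new where "new \<sigma> \<longleftrightarrow> \<sigma> \<in> K \<and> card \<sigma> = Suc k \<and> \<sigma> \<notin> L" for \<sigma>
    have "\<exists>F. continuous_map (simplex_topology \<sigma>) (R \<sigma>) F \<and>
        (\<forall>x\<in>geom_simplex \<sigma>. \<forall>v\<in>\<sigma>. x v = 0 \<longrightarrow> F x = f x)" if "new \<sigma>" for \<sigma>
    proof -
      have \<sigma>: "\<sigma> \<in> K" "\<sigma> \<noteq> {}" "card \<sigma> = Suc k" "finite \<sigma>"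
        using that fin by (auto simp: new_def)
      have "continuous_map (simplex_topology (\<sigma> - {v})) (R \<sigma>) f" if v: "v \<in> \<sigma>" for v
      proof (cases "\<sigma> - {v} = {}")
        case True
        show ?thesis unfolding True by (simp add: continuous_map_on_empty)
      next
        case False
        have "good k (\<sigma> - {v})"
          using False v \<sigma> abstract_complexD(2)[OF K \<sigma>(1)] by (auto simp: good_def)
        then have "continuous_map (simplex_topology (\<sigma> - {v})) (R (\<sigma> - {v})) f"
          using f unfolding P_def by blast
        then show ?thesis using R_mono[OF \<sigma>(1) False Diff_subset] by blast
      qed
      from continuous_map_on_simplex_boundary[OF \<sigma>(4) this]
      obtain F where "continuous_map (simplex_topology \<sigma>) (R \<sigma>) F"
        "\<And>x v. x \<in> geom_simplex \<sigma> \<Longrightarrow> v \<in> \<sigma> \<Longrightarrow> x v = 0 \<Longrightarrow> F x = f x"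
        using extend_from_simplex_boundary[of \<sigma> "R \<sigma>" f] contr[OF \<sigma>(1,2)] ne[OF \<sigma>(1,2)] \<sigma>
        unfolding R_def topspace_realization by blast
      then show ?thesis by blast
    qed
    then obtain e where e: "\<And>\<sigma>. new \<sigma> \<Longrightarrow> continuous_map (simplex_topology \<sigma>) (R \<sigma>) (e \<sigma>)"
      "\<And>\<sigma> x v. \<lbrakk>new \<sigma>; x \<in> geom_simplex \<sigma>; v \<in> \<sigma>; x v = 0\<rbrakk> \<Longrightarrow> e \<sigma> x = f x"
      by metis
    \<comment> \<open>The support of a point is either a new face, where the chosen extension
      applies, or it is not, where \<open>f\<close> is kept. On the boundary of a new face the
      support is smaller, and there the extension agrees with \<open>f\<close>.\<close>
    define f' where "f' x = (if new {v. x v \<noteq> 0} then e {v. x v \<noteq> 0} x else f x)" for x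
    have old: "f' x = f x" if \<sigma>: "good k \<sigma>" and x: "x \<in> geom_simplex \<sigma>" for \<sigma> x
    proof -
      have "{v. x v \<noteq> 0} \<subseteq> \<sigma>" "finite \<sigma>" "\<sigma> \<in> K"
        using support[OF x] \<sigma> fin by (auto simp: good_def)
      then have "\<not> new {v. x v \<noteq> 0}"
        using \<sigma> card_mono[of \<sigma> "{v. x v \<noteq> 0}"] abstract_complexD(2)[OF L]
        by (auto simp: good_def new_def)
      then show ?thesis by (simp add: f'_def)
    qed
    have f'_new: "f' x = e \<sigma> x" if \<sigma>: "new \<sigma>" and x: "x \<in> geom_simplex \<sigma>" for \<sigma> x
    proof (cases "{v. x v \<noteq> 0} = \<sigma>")
      case True
      then show ?thesis using \<sigma> by (simp add: f'_def)
    next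
      case False
      have \<sigma>': "\<sigma> \<in> K" "finite \<sigma>" using \<sigma> fin by (auto simp: new_def)
      then have "{v. x v \<noteq> 0} \<subset> \<sigma>" using support(4)[OF x] False by auto
      then obtain v where "v \<in> \<sigma>" "x v = 0" by auto
      moreover have "\<not> new {v. x v \<noteq> 0}"
        using psubset_card_mono[OF \<sigma>'(2) \<open>{v. x v \<noteq> 0} \<subset> \<sigma>\<close>] \<sigma> by (auto simp: new_def)
      ultimately show ?thesis using e(2)[OF \<sigma> x] by (simp add: f'_def)
    qed
    have "P (Suc k) f'"
      unfolding P_def
    proof (intro conjI allI impI ballI)
      fix x assume x: "x \<in> realization_set L"
      then obtain \<sigma> where \<sigma>: "\<sigma> \<in> L" "x \<in> geom_simplex \<sigma>" by (auto simp: realization_set_def)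
      then have "good k \<sigma>" using LK by (auto simp: good_def)
      then show "f' x = x" using old \<sigma> f x by (auto simp: P_def)
    next
      fix \<sigma> assume \<sigma>: "good (Suc k) \<sigma>"
      show "continuous_map (simplex_topology \<sigma>) (R \<sigma>) f'"
      proof (cases "good k \<sigma>")
        case True
        then have "continuous_map (simplex_topology \<sigma>) (R \<sigma>) f" using f by (auto simp: P_def)
        then show ?thesis by (rule continuous_map_eq) (use old True in auto)
      next
        case False
        then have n: "new \<sigma>" using \<sigma> by (auto simp: good_def new_def)
        show ?thesis by (rule continuous_map_eq[OF e(1)[OF n]]) (use f'_new n in auto)
      qed
    qed
    with old show ?thesis by blast
  qed
  obtain F where F: "\<And>k. P k (F k)"
    "\<And>k \<sigma> x. good k \<sigma> \<Longrightarrow> x \<in> geom_simplex \<sigma> \<Longrightarrow> F (Suc k) x = F k x"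
    using dependent_nat_choice[where P = P and
        Q = "\<lambda>k f f'. \<forall>\<sigma>. good k \<sigma> \<longrightarrow> (\<forall>x\<in>geom_simplex \<sigma>. f' x = f x)"] \<open>P 0 id\<close> step
    by metis
  have F_stable: "F j x = F k x" if "k \<le> j" "good k \<sigma>" "x \<in> geom_simplex \<sigma>" for j k \<sigma> x
    using that(1)
  proof (induction j rule: dec_induct)
    case (step j)
    then have "good j \<sigma>" using that(2) by (auto simp: good_def)
    then show ?case using F(2) step that(3) by metis
  qed simp
  \<comment> \<open>The limit of the stages: once the support has at most \<open>k\<close> vertices
    the value no longer changes after stage \<open>k\<close>.\<close>
  define r where "r x = F (card {v. x v \<noteq> 0}) x" for x
  have r: "continuous_map (simplex_topology \<sigma>) (R \<sigma>) r" if \<sigma>: "\<sigma> \<in> K" "\<sigma> \<noteq> {}" for \<sigma>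
  proof (rule continuous_map_eq)
    show "continuous_map (simplex_topology \<sigma>) (R \<sigma>) (F (card \<sigma>))"
      using F(1)[of "card \<sigma>"] \<sigma> by (auto simp: P_def good_def)
    fix x assume "x \<in> topspace (simplex_topology \<sigma>)"
    then have x: "x \<in> geom_simplex \<sigma>" by simp
    note s = support[OF x \<sigma>(1)]
    have "good (card {v. x v \<noteq> 0}) {v. x v \<noteq> 0}" using s unfolding good_def by simp
    then show "F (card \<sigma>) x = r x"
      unfolding r_def using F_stable s card_mono[OF fin[OF \<sigma>(1)] s(4)] by blast
  qed
  have r_L: "r x = x" if "x \<in> realization_set L" for x
    using F(1) that by (auto simp: P_def r_def)
  have contr_L: "continuous_map (realization K) (realization L) r"
  proof (rule continuous_map_from_realization)
    fix \<sigma> assume \<sigma>: "\<sigma> \<in> K" "finite \<sigma>"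
    show "continuous_map (simplex_topology \<sigma>) (realization L) r"
    proof (cases "\<sigma> = {}")
      case True
      then show ?thesis by (simp add: continuous_map_on_empty)
    next
      case False
      have "continuous_map (R \<sigma>) (realization L) id"
        unfolding R_def by (rule continuous_map_realization_mono) (auto simp: full_subcomplex_def)
      from continuous_map_compose[OF r[OF \<sigma>(1) False] this] show ?thesis by simp
    qed
  qed
  have incl: "continuous_map (realization L) (realization K) id"
    by (rule continuous_map_realization_mono[OF LK])
  have "homotopic_with (\<lambda>x. True) (realization K) (realization K) (id \<circ> r) id"
  proof (rule homotopic_realization_linear[OF continuous_map_compose[OF contr_L incl] continuous_map_id])
    fix \<sigma> assume \<sigma>: "\<sigma> \<in> K" "finite \<sigma>"
    show "\<exists>W\<in>K. finite W \<and> (id \<circ> r) ` geom_simplex \<sigma> \<subseteq> geom_simplex W \<and> id ` geom_simplex \<sigma> \<subseteq> geom_simplex W"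
    proof (cases "\<sigma> = {}")
      case True
      then show ?thesis using \<sigma> by auto
    next
      case False
      note VK = V[OF \<sigma>(1) False]
      have "r ` geom_simplex \<sigma> \<subseteq> realization_set (full_subcomplex L (V \<sigma>))"
        using r[OF \<sigma>(1) False] unfolding continuous_map R_def by simp
      also have "\<dots> \<subseteq> geom_simplex (V \<sigma>)"
        using realization_set_full_subcomplex_subset VK fin by blast
      finally show ?thesis
        using VK fin geom_simplex_mono[of \<sigma> "V \<sigma>"] by (intro bexI[of _ "V \<sigma>"]) auto
    qed
  qed
  moreover have "homotopic_with (\<lambda>x. True) (realization L) (realization L) (r \<circ> id) id"
    by (rule homotopic_with_equal; (rule TrueI continuous_map_compose[OF incl contr_L])?) (simp add: r_L)
  ultimately show ?thesis
    unfolding homotopy_equivalence_map_def using incl contr_L by blast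
qed

section \<open>Contractible complexes and removal of dominated vertices\<close>

lemma contractible_space_simplex:
  assumes "finite W" "W \<noteq> {}"
  shows "contractible_space (realization (Pow W))"
proof -
  obtain w where w: "w \<in> W" using assms by auto
  define p where "p = (\<lambda>v. if v = w then 1 else 0 :: real)"
  have p: "p \<in> geom_simplex W"
    using w assms by (auto simp: p_def geom_simplex_def)
  have "homotopic_with (\<lambda>x. True) (realization (Pow W)) (realization (Pow W)) id (\<lambda>x. p)"
  proof (rule homotopic_realization_linear)
    show "continuous_map (realization (Pow W)) (realization (Pow W)) (\<lambda>x. p)"
      using p assms by (auto simp: realization_set_def)
    show "\<exists>U\<in>Pow W. finite U \<and> id ` geom_simplex \<sigma> \<subseteq> geom_simplex U \<and> (\<lambda>x. p) ` geom_simplex \<sigma> \<subseteq> geom_simplex U"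
      if "\<sigma> \<in> Pow W" for \<sigma>
      using that assms p geom_simplex_mono[of \<sigma> W] by (intro bexI[of _ W]) auto
  qed auto
  then show ?thesis unfolding contractible_space_def by blast
qed

lemma realization_set_nonempty:
  assumes "{v} \<in> K"
  shows "realization_set K \<noteq> {}"
proof -
  have "(\<lambda>u. if u = v then 1 else 0) \<in> geom_simplex {v}"
    by (auto simp: geom_simplex_def)
  then show ?thesis using assms by (auto simp: realization_set_def)
qed

lemma full_subcomplex_eq_Pow:
  assumes "abstract_complex L" "W \<in> L"
  shows "full_subcomplex L W = Pow W"
  using abstract_complexD(2)[OF assms] unfolding full_subcomplex_def by blast

lemma homotopy_equivalence_map_imp_space:
  "homotopy_equivalence_map X Y f \<Longrightarrow> X homotopy_equivalent_space Y"
  unfolding homotopy_equivalence_map_def homotopy_equivalent_space_def by blast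

lemma abstract_complex_full_subcomplex:
  "abstract_complex K \<Longrightarrow> abstract_complex (full_subcomplex K W)"
  unfolding abstract_complex_def full_subcomplex_def by blast

text \<open>An elementary strong collapse, obtained from the fibre lemma. The carrier adds
  \<open>b'\<close> to every face containing \<open>b\<close>. Without \<open>b\<close> it is still
  a face and still nonempty, so the full subcomplex on it is a whole simplex.\<close>

lemma contractible_dominated_vertex:
  assumes K: "abstract_complex K" and b: "b' \<noteq> b" "{b'} \<in> K"
    and dom: "\<And>\<tau>. \<tau> \<in> K \<Longrightarrow> b \<in> \<tau> \<Longrightarrow> insert b' \<tau> \<in> K"
    and contr: "contractible_space (realization (full_subcomplex K (- {b})))"
  shows "contractible_space (realization K)"
proof -
  define L where "L = full_subcomplex K (- {b})"
  define V where "V \<sigma> = (if b \<in> \<sigma> then insert b' \<sigma> else \<sigma>)" for \<sigma>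
  have L: "abstract_complex L" unfolding L_def by (rule abstract_complex_full_subcomplex[OF K])
  have VK: "\<sigma> \<subseteq> V \<sigma> \<and> V \<sigma> \<in> K" if "\<sigma> \<in> K" for \<sigma>
    using that dom by (auto simp: V_def)
  have full: "full_subcomplex L (V \<sigma>) = Pow (V \<sigma> - {b})" "finite (V \<sigma> - {b})" if "\<sigma> \<in> K" for \<sigma>
    using VK[OF that] abstract_complexD(1)[OF K]
    by (auto simp: full_subcomplex_def L_def intro: abstract_complexD(2)[OF K, of "V \<sigma>"])
  have ne: "V \<sigma> - {b} \<noteq> {}" if "\<sigma> \<noteq> {}" for \<sigma>
    using that b by (auto simp: V_def)
  have "homotopy_equivalence_map (realization L) (realization K) id"
  proof (rule homotopy_equivalence_subcomplex[OF K L, where V = V])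
    fix \<sigma> assume \<sigma>: "\<sigma> \<in> K" "\<sigma> \<noteq> {}"
    show "contractible_space (realization (full_subcomplex L (V \<sigma>)))"
      using full[OF \<sigma>(1)] ne[OF \<sigma>(2)] contractible_space_simplex by metis
    obtain v where "v \<in> V \<sigma> - {b}" using ne[OF \<sigma>(2)] by blast
    then show "realization_set (full_subcomplex L (V \<sigma>)) \<noteq> {}"
      using full[OF \<sigma>(1)] by (intro realization_set_nonempty[of v]) auto
  qed (use VK in \<open>auto simp: L_def full_subcomplex_def V_def\<close>)
  then show ?thesis
    using homotopy_equivalence_map_imp_space homotopy_equivalent_space_contractibility contr
    unfolding L_def by blast
qed

section \<open>Sets covered by short arcs\<close>

text \<open>\<open>frac (x - y)\<close> is the length of the forward arc from \<open>y\<close> to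
  \<open>x\<close>. Rewriting with this rule turns arguments about cyclic order into case splits in
  linear arithmetic.\<close>

lemma frac_diff_circle:
  assumes "x \<in> circle" "y \<in> circle"
  shows "frac (x - y) = (if y \<le> x then x - y else x - y + 1)"
  using assms by (auto simp: circle_def frac_unique_iff)

text \<open>The complex T of the overview. A centre \<open>c\<close> is the initial point of its
  arc, not its midpoint.\<close>

definition arc_cover_complex :: "nat \<Rightarrow> real \<Rightarrow> real set set" where
  "arc_cover_complex n \<epsilon> = {\<sigma>. finite \<sigma> \<and> \<sigma> \<subseteq> circle \<and>
     (\<exists>C. finite C \<and> C \<subseteq> circle \<and> card C \<le> n \<and> (\<forall>x\<in>\<sigma>. \<exists>c\<in>C. frac (x - c) \<le> \<epsilon>))}"

text \<open>The points preceded by a gap longer than \<epsilon>, so the cardinality of this set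
  counts such gaps. In a one-point set the point is a start for every \<epsilon>.\<close>

definition arc_starts :: "real \<Rightarrow> real set \<Rightarrow> real set" where
  "arc_starts \<epsilon> V = {b\<in>V. \<forall>x\<in>V. x \<noteq> b \<longrightarrow> \<epsilon> < frac (b - x)}"

lemma abstract_complex_arc_cover: "abstract_complex (arc_cover_complex n \<epsilon>)"
  unfolding abstract_complex_def arc_cover_complex_def
proof (intro ballI conjI subsetI)
  fix \<sigma> \<tau> :: "real set" assume "\<tau> \<in> Pow \<sigma>"
    "\<sigma> \<in> {\<sigma>. finite \<sigma> \<and> \<sigma> \<subseteq> circle \<and>
     (\<exists>C. finite C \<and> C \<subseteq> circle \<and> card C \<le> n \<and> (\<forall>x\<in>\<sigma>. \<exists>c\<in>C. frac (x - c) \<le> \<epsilon>))}"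
  then show "\<tau> \<in> {\<sigma>. finite \<sigma> \<and> \<sigma> \<subseteq> circle \<and>
     (\<exists>C. finite C \<and> C \<subseteq> circle \<and> card C \<le> n \<and> (\<forall>x\<in>\<sigma>. \<exists>c\<in>C. frac (x - c) \<le> \<epsilon>))}"
    by (elim CollectE conjE exE, intro CollectI conjI exI) (auto intro: finite_subset)
qed auto

lemma arc_cover_complexI:
  assumes "finite \<sigma>" "\<sigma> \<subseteq> circle" "finite C" "C \<subseteq> circle" "card C \<le> n"
    "\<And>x. x \<in> \<sigma> \<Longrightarrow> \<exists>c\<in>C. frac (x - c) \<le> \<epsilon>"
  shows "\<sigma> \<in> arc_cover_complex n \<epsilon>"
  unfolding arc_cover_complex_def using assms by (intro CollectI conjI exI[of _ C]) auto

lemma arc_cover_complexE: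
  assumes "\<sigma> \<in> arc_cover_complex n \<epsilon>"
  obtains C where "finite \<sigma>" "\<sigma> \<subseteq> circle" "finite C" "C \<subseteq> circle" "card C \<le> n"
    "\<And>x. x \<in> \<sigma> \<Longrightarrow> \<exists>c\<in>C. frac (x - c) \<le> \<epsilon>"
  using assms unfolding arc_cover_complex_def by (elim CollectE conjE exE) (rule that, auto)

text \<open>The arc that covers \<open>b\<close> can be pushed forward until it starts at
  \<open>b\<close>. No other point of \<open>V\<close> lies within \<epsilon> behind
  \<open>b\<close>, so nothing covered is lost, and the moved arc reaches \<open>b'\<close>. The
  number of arcs does not grow.\<close>

lemma arc_start_dominated:
  assumes V: "V \<subseteq> circle" and b: "b \<in> arc_starts \<epsilon> V" and b': "b' \<in> V" "frac (b' - b) \<le> \<epsilon>" and "0 \<le> \<epsilon>"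
    and \<tau>: "\<tau> \<in> full_subcomplex (arc_cover_complex n \<epsilon>) V" "b \<in> \<tau>"
  shows "insert b' \<tau> \<in> full_subcomplex (arc_cover_complex n \<epsilon>) V"
proof -
  have "\<tau> \<in> arc_cover_complex n \<epsilon>" and tV: "\<tau> \<subseteq> V"
    using \<tau>(1) by (auto simp: full_subcomplex_def)
  then obtain C where C: "finite C" "C \<subseteq> circle" "card C \<le> n" "\<And>x. x \<in> \<tau> \<Longrightarrow> \<exists>c\<in>C. frac (x - c) \<le> \<epsilon>"
    and t: "finite \<tau>"
    by (elim arc_cover_complexE) (rule that)
  obtain c where c: "c \<in> C" "frac (b - c) \<le> \<epsilon>" using C(4) \<tau>(2) by blast
  have bV: "b \<in> V" using b by (simp add: arc_starts_def)
  define C' where "C' = insert b (C - {c})"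
  have "card C' \<le> n"
    using C(3) card_Suc_Diff1[OF C(1) c(1)] card_insert_le_m1[of n "C - {c}" b] unfolding C'_def
    by simp
  moreover have "\<exists>c\<in>C'. frac (x - c) \<le> \<epsilon>" if x: "x \<in> insert b' \<tau>" for x
  proof (cases "x = b' \<or> x = b")
    case True
    then show ?thesis using b' \<open>0 \<le> \<epsilon>\<close> by (auto simp: C'_def)
  next
    case False
    then obtain d where d: "d \<in> C" "frac (x - d) \<le> \<epsilon>" using C(4) x by blast
    show ?thesis
    proof (cases "d = c")
      case True
      have "x \<in> V" using x False tV by auto
      then have "\<epsilon> < frac (b - x)" using b False by (auto simp: arc_starts_def)
      moreover have "x \<in> circle" "b \<in> circle" "c \<in> circle"
        using \<open>x \<in> V\<close> V bV C c by auto
      ultimately have "frac (x - b) \<le> \<epsilon>"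
        using c(2) d(2) True
        by (auto simp: frac_diff_circle circle_def split: if_splits)
      then show ?thesis by (auto simp: C'_def)
    qed (use d in \<open>auto simp: C'_def\<close>)
  qed
  moreover have "finite C'" "C' \<subseteq> circle" using C bV V by (auto simp: C'_def)
  moreover have "insert b' \<tau> \<subseteq> V" using tV b' by auto
  ultimately have "insert b' \<tau> \<in> arc_cover_complex n \<epsilon>"
    using t V by (intro arc_cover_complexI[where C = C']) auto
  with \<open>insert b' \<tau> \<subseteq> V\<close> show ?thesis by (simp add: full_subcomplex_def)
qed

text \<open>As long as some start \<open>b\<close> has a point within \<epsilon> ahead, the first
  point after \<open>b\<close> dominates it; deleting \<open>b\<close> hands the role of start to
  that point, so the count of starts does not rise. When no such \<open>b\<close> is left, all
  points are starts, there are at most \<open>n\<close> of them, and \<open>V\<close> is itself a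
  face: one arc begins at each point.\<close>

lemma contractible_arc_cover:
  assumes "finite V" "V \<subseteq> circle" "arc_starts \<epsilon> V \<noteq> {}" "card (arc_starts \<epsilon> V) \<le> n" "0 \<le> \<epsilon>"
  shows "contractible_space (realization (full_subcomplex (arc_cover_complex n \<epsilon>) V))"
  using assms
proof (induction V rule: finite_psubset_induct)
  case (psubset V)
  let ?T = "arc_cover_complex n \<epsilon>"
  note V = psubset.prems(1)
  show ?case
  proof (cases "\<exists>b\<in>arc_starts \<epsilon> V. \<exists>y\<in>V. y \<noteq> b \<and> frac (y - b) \<le> \<epsilon>")
    case True
    then obtain b y where b: "b \<in> arc_starts \<epsilon> V" and y: "y \<in> V - {b}" "frac (y - b) \<le> \<epsilon>" by blast
    define b' where "b' = arg_min_on (\<lambda>y. frac (y - b)) (V - {b})"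
    have b': "b' \<in> V - {b}" "\<And>z. z \<in> V - {b} \<Longrightarrow> frac (b' - b) \<le> frac (z - b)"
      using arg_min_if_finite(1)[of "V - {b}" "\<lambda>y. frac (y - b)"]
        arg_min_least[of "V - {b}" _ "\<lambda>y. frac (y - b)"] psubset.hyps y
      unfolding b'_def by auto
    then have b'\<epsilon>: "frac (b' - b) \<le> \<epsilon>" using y by (meson order_trans)
    have bV: "b \<in> V" and bst: "\<And>x. x \<in> V \<Longrightarrow> x \<noteq> b \<Longrightarrow> \<epsilon> < frac (b - x)"
      using b by (auto simp: arc_starts_def)
    have circ: "b \<in> circle" "b' \<in> circle" using bV b' V by auto
    \<comment> \<open>A point other than \<open>b'\<close> cannot become a start by the removal of
      \<open>b\<close>: if \<open>b\<close> was within \<epsilon> behind it, then \<open>b'\<close>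
      lies in between and is closer still.\<close>
    have sub: "arc_starts \<epsilon> (V - {b}) \<subseteq> insert b' (arc_starts \<epsilon> V - {b})"
    proof
      fix x assume x: "x \<in> arc_starts \<epsilon> (V - {b})"
      then have xV: "x \<in> V" "x \<noteq> b" by (auto simp: arc_starts_def)
      show "x \<in> insert b' (arc_starts \<epsilon> V - {b})"
      proof (cases "x = b'")
        case False
        have "\<epsilon> < frac (x - b')" using x b' False by (auto simp: arc_starts_def)
        moreover have "frac (b' - b) \<le> frac (x - b)" using b' xV by blast
        moreover have "x \<in> circle" using xV V by auto
        ultimately have "\<epsilon> < frac (x - b)"
          using circ by (auto simp: frac_diff_circle circle_def split: if_splits)
        with x xV show ?thesis by (auto simp: arc_starts_def)
      qed auto
    qed
    have "\<epsilon> < frac (b' - x)" if x: "x \<in> V - {b}" "x \<noteq> b'" for x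
    proof -
      have "frac (b' - b) \<le> frac (x - b)" using b' x by blast
      moreover have "\<epsilon> < frac (b - x)" using bst x by auto
      moreover have "x \<in> circle" using x V by auto
      ultimately show ?thesis
        using circ b' x by (auto simp: frac_diff_circle circle_def split: if_splits)
    qed
    then have b'st: "b' \<in> arc_starts \<epsilon> (V - {b})" using b' by (auto simp: arc_starts_def)
    have fin: "finite (arc_starts \<epsilon> V)" using psubset.hyps by (auto simp: arc_starts_def)
    have "card (arc_starts \<epsilon> (V - {b})) \<le> card (insert b' (arc_starts \<epsilon> V - {b}))"
      by (rule card_mono) (use fin sub in auto)
    also have "\<dots> \<le> Suc (card (arc_starts \<epsilon> V - {b}))" by (rule card_insert_le_m1[THEN order_trans]) auto
    also have "\<dots> = card (arc_starts \<epsilon> V)" using fin b by (rule card_Suc_Diff1)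
    finally have contr: "contractible_space (realization (full_subcomplex ?T (V - {b})))"
      using psubset.prems bV b'st by (intro psubset.IH) auto
    have eq: "full_subcomplex (full_subcomplex ?T V) (- {b}) = full_subcomplex ?T (V - {b})"
      by (auto simp: full_subcomplex_def)
    have b'T: "{b'} \<in> full_subcomplex ?T V"
    proof -
      have "1 \<le> n" using psubset.prems(3,4) b fin by (metis One_nat_def Suc_leI card_gt_0_iff empty_iff le_trans)
      then show ?thesis
        using b' circ psubset.prems(4) unfolding full_subcomplex_def
        by (auto intro!: arc_cover_complexI[where C = "{b'}"])
    qed
    show ?thesis
    proof (rule contractible_dominated_vertex[where b = b and b' = b'])
      show "insert b' \<tau> \<in> full_subcomplex ?T V" if "\<tau> \<in> full_subcomplex ?T V" "b \<in> \<tau>" for \<tau>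
        using arc_start_dominated[OF V b _ b'\<epsilon> psubset.prems(4) that] b' by blast
    qed (use b' b'T eq contr abstract_complex_full_subcomplex[OF abstract_complex_arc_cover] in auto)
  next
    case False
    have "V \<subseteq> arc_starts \<epsilon> V"
    proof (rule ccontr)
      assume "\<not> V \<subseteq> arc_starts \<epsilon> V"
      then have ne: "V - arc_starts \<epsilon> V \<noteq> {}" by auto
      obtain b where b: "b \<in> arc_starts \<epsilon> V" using psubset.prems by auto
      \<comment> \<open>Let \<open>x\<close> be the first non-start after \<open>b\<close>, and
        \<open>y\<close> a point within \<epsilon> behind \<open>x\<close>. By the case assumption
        \<open>y\<close> is not a start, so by minimality it comes after \<open>x\<close> when
        counted from \<open>b\<close>. The short arc from \<open>y\<close> to \<open>x\<close> then
        passes through \<open>b\<close>, and \<open>b\<close> would not be a start.\<close>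
      define x where "x = arg_min_on (\<lambda>y. frac (y - b)) (V - arc_starts \<epsilon> V)"
      have x: "x \<in> V - arc_starts \<epsilon> V"
        "\<And>z. z \<in> V - arc_starts \<epsilon> V \<Longrightarrow> frac (x - b) \<le> frac (z - b)"
        using arg_min_if_finite(1)[of "V - arc_starts \<epsilon> V" "\<lambda>y. frac (y - b)"]
          arg_min_least[of "V - arc_starts \<epsilon> V" _ "\<lambda>y. frac (y - b)"] psubset.hyps ne
        unfolding x_def by auto
      then obtain y where y: "y \<in> V" "y \<noteq> x" "frac (x - y) \<le> \<epsilon>"
        by (force simp: arc_starts_def)
      have "y \<notin> arc_starts \<epsilon> V"
      proof
        assume "y \<in> arc_starts \<epsilon> V"
        then have "\<exists>b\<in>arc_starts \<epsilon> V. \<exists>y\<in>V. y \<noteq> b \<and> frac (y - b) \<le> \<epsilon>"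
          using x(1) y(2,3) by (intro bexI[of _ y] bexI[of _ x]) auto
        with False show False by simp
      qed
      then have "y \<noteq> b" "frac (x - b) \<le> frac (y - b)" using x y b by auto
      moreover have "\<epsilon> < frac (b - y)" using b y \<open>y \<noteq> b\<close> by (auto simp: arc_starts_def)
      moreover have "x \<in> circle" "y \<in> circle" "b \<in> circle"
        using V x y b by (auto simp: arc_starts_def)
      ultimately show False
        using y by (auto simp: frac_diff_circle circle_def split: if_splits)
    qed
    then have "V = arc_starts \<epsilon> V" by (auto simp: arc_starts_def)
    then have "card V \<le> n" "V \<noteq> {}" using psubset.prems by auto
    then have "V \<in> ?T"
      using psubset.hyps psubset.prems by (intro arc_cover_complexI[where C = V] bexI) auto
    then show ?thesis
      using full_subcomplex_eq_Pow[OF abstract_complex_arc_cover] contractible_space_simplex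
        psubset.hyps \<open>V \<noteq> {}\<close> by metis
  qed
qed

section \<open>Sets with a long gap\<close>

definition gap_complex :: "real \<Rightarrow> real set set" where
  "gap_complex s = {\<sigma>. finite \<sigma> \<and> \<sigma> \<subseteq> circle \<and> (\<sigma> = {} \<or> arc_starts s \<sigma> \<noteq> {})}"

lemma finite_obtain_arg_min:
  fixes f :: "'a \<Rightarrow> real"
  assumes "finite A" "A \<noteq> {}"
  obtains a where "a \<in> A" "\<And>x. x \<in> A \<Longrightarrow> f a \<le> f x"
proof (rule that)
  show "arg_min_on f A \<in> A" by (rule arg_min_if_finite(1)[OF assms])
  show "f (arg_min_on f A) \<le> f x" if "x \<in> A" for x by (rule arg_min_least[OF assms that])
qed

text \<open>The point \<open>b\<close> need not belong to the set: if the arc of length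
  \<open>s\<close> behind \<open>b\<close> is free, the first point of \<tau> met from
  \<open>b\<close> onwards has an equally long free arc behind it.\<close>

lemma gap_complexI:
  assumes "finite \<tau>" "\<tau> \<subseteq> circle" "b \<in> circle" "s < 1" "\<And>x. x \<in> \<tau> \<Longrightarrow> x \<noteq> b \<Longrightarrow> s < frac (b - x)"
  shows "\<tau> \<in> gap_complex s"
proof (cases "\<tau> = {}")
  case False
  obtain b' where b': "b' \<in> \<tau>" "\<And>x. x \<in> \<tau> \<Longrightarrow> frac (b' - b) \<le> frac (x - b)"
    using finite_obtain_arg_min[OF assms(1) False, of "\<lambda>x. frac (x - b)"] by blast
  have "s < frac (b' - x)" if x: "x \<in> \<tau>" "x \<noteq> b'" for x
  proof -
    have c: "x \<in> circle" "b' \<in> circle" using x b' assms by auto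
    show ?thesis
      using b'(2)[OF x(1)] assms(5)[OF x(1)] c assms(3,4) x(2)
      by (cases "x = b") (auto simp: frac_diff_circle circle_def split: if_splits)
  qed
  then have "b' \<in> arc_starts s \<tau>" using b' by (simp add: arc_starts_def)
  then show ?thesis using assms by (auto simp: gap_complex_def)
qed (simp add: gap_complex_def)

lemma abstract_complex_gap:
  assumes "s < 1"
  shows "abstract_complex (gap_complex s)"
  unfolding abstract_complex_def
proof (intro ballI conjI subsetI)
  fix \<sigma> \<tau> assume \<sigma>: "\<sigma> \<in> gap_complex s" and \<tau>: "\<tau> \<in> Pow \<sigma>"
  show "\<tau> \<in> gap_complex s"
  proof (cases "\<sigma> = {}")
    case True
    then show ?thesis using \<sigma> \<tau> by simp
  next
    case False
    then obtain b where "b \<in> arc_starts s \<sigma>" using \<sigma> by (auto simp: gap_complex_def)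
    then show ?thesis
      using \<sigma> \<tau> assms by (intro gap_complexI[where b = b]) (auto simp: gap_complex_def arc_starts_def intro: finite_subset)
  qed
qed (simp add: gap_complex_def)

text \<open>A finite set lies in an open arc of length \<open>2 * r\<close> iff the complementary
  gap is strictly longer than \<open>1 - 2 * r\<close>.\<close>

lemma cech_complex_eq_gap_complex:
  assumes "0 < r" "r < 1/2"
  shows "cech_complex circle r = gap_complex (1 - 2 * r)"
proof (intro set_eqI iffI)
  fix \<sigma> assume "\<sigma> \<in> cech_complex circle r"
  then obtain z where \<sigma>: "\<sigma> \<subseteq> circle" "finite \<sigma>" and z: "z \<in> circle"
    and "\<And>x. x \<in> \<sigma> \<Longrightarrow> circle_dist x z < r"
    by (auto simp: cech_complex_def circle_ball_def)
  then have d: "frac (x - z) < r \<or> frac (z - x) < r" if "x \<in> \<sigma>" for x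
    using that by (fastforce simp: circle_dist_def)
  \<comment> \<open>The initial point of the open arc of length \<open>2 * r\<close> centred at
    \<open>z\<close>, brought back into the interval.\<close>
  define w where "w = (if r \<le> z then z - r else z - r + 1)"
  have w: "w \<in> circle" using z assms by (auto simp: w_def circle_def)
  have dw: "frac (x - w) < 2 * r" if "x \<in> \<sigma>" for x
  proof -
    have "x \<in> circle" using that \<sigma> by auto
    then show ?thesis
      using d[OF that] z w assms by (auto simp: w_def frac_diff_circle circle_def split: if_splits)
  qed
  show "\<sigma> \<in> gap_complex (1 - 2 * r)"
  proof (rule gap_complexI[OF \<sigma>(2,1) w])
    fix x assume x: "x \<in> \<sigma>" "x \<noteq> w"
    then have "x \<in> circle" using \<sigma> by auto
    then show "1 - 2 * r < frac (w - x)"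
      using dw[OF x(1)] w x(2) by (auto simp: frac_diff_circle split: if_splits)
  qed (use assms in auto)
next
  fix \<sigma> assume "\<sigma> \<in> gap_complex (1 - 2 * r)"
  then have \<sigma>: "finite \<sigma>" "\<sigma> \<subseteq> circle" "\<sigma> = {} \<or> arc_starts (1 - 2 * r) \<sigma> \<noteq> {}"
    by (auto simp: gap_complex_def)
  show "\<sigma> \<in> cech_complex circle r"
  proof (cases "\<sigma> = {}")
    case True
    then show ?thesis by (auto simp: cech_complex_def circle_def intro!: exI[of _ 0])
  next
    case False
    then obtain b where b: "b \<in> \<sigma>" "\<And>x. x \<in> \<sigma> \<Longrightarrow> x \<noteq> b \<Longrightarrow> 1 - 2 * r < frac (b - x)"
      using \<sigma> by (auto simp: arc_starts_def)
    obtain a where a: "a \<in> \<sigma>" "\<And>x. x \<in> \<sigma> \<Longrightarrow> frac (x - b) \<le> frac (a - b)"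
      using finite_obtain_arg_min[OF \<sigma>(1) False, of "\<lambda>x. - frac (x - b)"] by (metis neg_le_iff_le)
    \<comment> \<open>The set occupies the arc from \<open>b\<close>, where the long gap ends, to
      the last point \<open>a\<close>. Its length is less than \<open>2 * r\<close>, so its midpoint
      \<open>z\<close> is closer than \<open>r\<close> to every point.\<close>
    define U where "U = frac (a - b)"
    have bc: "b \<in> circle" "a \<in> circle" using b a \<sigma> by auto
    have U: "0 \<le> U" "U < 2 * r"
      using b(2)[OF a(1)] bc assms unfolding U_def
      by (cases "a = b"; auto simp: frac_diff_circle circle_def split: if_splits)+
    define z where "z = (if b + U/2 < 1 then b + U/2 else b + U/2 - 1)"
    have z: "z \<in> circle" using bc U assms by (auto simp: z_def circle_def)
    have "circle_dist x z < r" if x: "x \<in> \<sigma>" for x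
    proof -
      have xc: "x \<in> circle" using x \<sigma> by auto
      have "frac (x - b) \<le> U" using a(2)[OF x] by (simp add: U_def)
      then have "frac (x - z) \<le> U/2 \<or> frac (z - x) \<le> U/2"
        using xc z bc U assms by (auto simp: z_def frac_diff_circle circle_def split: if_splits)
      then show ?thesis using U by (auto simp: circle_dist_def)
    qed
    then show ?thesis
      using \<sigma> z by (auto simp: cech_complex_def circle_ball_def)
  qed
qed

section \<open>Counting gaps along the circle\<close>

lemma Max_Min_insert_greater:
  fixes A :: "real set"
  assumes "finite A" "A \<noteq> {}" "\<forall>a\<in>A. a < b"
  shows "Max (insert b A) = b" "Min (insert b A) = Min A"
proof -
  have "Max A < b" "Min A < b" using assms by auto
  then show "Max (insert b A) = b" "Min (insert b A) = Min A" using assms by auto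
qed

lemma spread_lower_bound:
  fixes S :: "real set"
  assumes "finite S" "S \<noteq> {}" "\<And>x y. x \<in> S \<Longrightarrow> y \<in> S \<Longrightarrow> x < y \<Longrightarrow> s \<le> y - x"
  shows "(real (card S) - 1) * s \<le> Max S - Min S"
  using assms
proof (induction S rule: finite_linorder_max_induct)
  case (insert b A)
  show ?case
  proof (cases "A = {}")
    case False
    have "Max A \<in> A" using insert False by auto
    then have "s \<le> b - Max A" using insert by auto
    moreover have "(real (card A) - 1) * s \<le> Max A - Min A" using insert False by auto
    moreover have "b \<notin> A" using insert by auto
    ultimately show ?thesis
      using insert.hyps False by (simp add: Max_Min_insert_greater algebra_simps del: Max_insert Min_insert)
  qed simp
qed simp

lemma spread_upper_bound:
  fixes S :: "real set"
  assumes "finite S" "S \<noteq> {}" "\<And>x. x \<in> S \<Longrightarrow> x \<noteq> Min S \<Longrightarrow> \<exists>y\<in>S. y < x \<and> x - y \<le> a"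
  shows "Max S - Min S \<le> (real (card S) - 1) * a"
  using assms
proof (induction S rule: finite_linorder_max_induct)
  case (insert b A)
  show ?case
  proof (cases "A = {}")
    case False
    note M = Max_Min_insert_greater[OF insert.hyps(1) False insert.hyps(2)]
    have b: "b \<notin> A" using insert by auto
    have "\<exists>y\<in>A. y < x \<and> x - y \<le> a" if x: "x \<in> A" "x \<noteq> Min A" for x
    proof -
      obtain y where "y \<in> insert b A" "y < x" "x - y \<le> a"
        using insert.prems(2)[of x] x unfolding M by auto
      moreover have "y \<noteq> b" using insert x \<open>y < x\<close> by force
      ultimately show ?thesis by auto
    qed
    then have "Max A - Min A \<le> (real (card A) - 1) * a" using insert False by blast
    moreover have "b - Max A \<le> a"
    proof -
      have "b \<noteq> Min A" using b Min_in[OF insert.hyps(1) False] by metis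
      then obtain y where "y \<in> insert b A" "y < b" "b - y \<le> a"
        using insert.prems(2)[of b] unfolding M by auto
      moreover from this have "y \<le> Max A" using insert by auto
      ultimately show ?thesis by auto
    qed
    ultimately show ?thesis using insert.hyps(1) b unfolding M by (simp add: algebra_simps)
  qed simp
qed simp

text \<open>Two or more starts cut the circle into as many arcs, each longer than \<open>s\<close>,
  one of them crossing 0 from the largest to the smallest start. Their lengths add up to 1, so
  \<open>n + 1\<close> starts would contradict \<open>1 \<le> (real n + 1) * s\<close>. A single
  start has no second arc end and is treated apart.\<close>

lemma card_arc_starts_le:
  assumes "finite \<sigma>" "\<sigma> \<subseteq> circle" "1 \<le> (real n + 1) * s" "1 \<le> n"
  shows "card (arc_starts s \<sigma>) \<le> n"
proof (cases "card (arc_starts s \<sigma>) \<le> 1")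
  case False
  let ?S = "arc_starts s \<sigma>"
  have fin: "finite ?S" and circ: "?S \<subseteq> circle" using assms by (auto simp: arc_starts_def)
  have ne: "?S \<noteq> {}" using False by auto
  have far: "s < frac (x - y)" if "x \<in> ?S" "y \<in> ?S" "x \<noteq> y" for x y
    using that by (auto simp: arc_starts_def)
  have "s \<le> y - x" if "x \<in> ?S" "y \<in> ?S" "x < y" for x y
    using far[of y x] that circ by (auto simp: frac_diff_circle subset_iff)
  then have "(real (card ?S) - 1) * s \<le> Max ?S - Min ?S"
    by (rule spread_lower_bound[OF fin ne])
  moreover have "s < 1 - (Max ?S - Min ?S)"
  proof -
    have mm: "Min ?S \<in> ?S" "Max ?S \<in> ?S" using fin ne by auto
    have "Min ?S \<noteq> Max ?S"
      using False fin ne by (metis card.empty card_insert_disjoint Max_ge Min_le antisym finite.emptyI insert_absorb le_refl One_nat_def is_singletonI' is_singleton_altdef)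
    moreover from this have "Min ?S < Max ?S" using fin ne by (metis Min_le mm(2) order_less_le)
    ultimately show ?thesis
      using far[of "Min ?S" "Max ?S"] mm circ by (auto simp: frac_diff_circle subset_iff)
  qed
  ultimately have "real (card ?S) * s < 1" by (simp add: algebra_simps)
  then have "real (card ?S) * s < (real n + 1) * s" using assms by simp
  moreover have "0 < s"
  proof (rule ccontr)
    assume "\<not> 0 < s"
    then have "(real n + 1) * s \<le> 0" by (simp add: mult_nonneg_nonpos)
    then show False using assms by simp
  qed
  ultimately show ?thesis by simp
qed (use assms in auto)

text \<open>If every point had another one within \<open>a\<close> behind it, steps of length at
  most \<open>a\<close> would close up around the circle, one for each point of \<open>C\<close>,
  giving total length at most \<open>card C * a\<close>.\<close>

lemma arc_starts_nonempty:
  assumes "finite C" "C \<noteq> {}" "C \<subseteq> circle" "real (card C) * a < 1"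
  shows "arc_starts a C \<noteq> {}"
proof
  assume empty: "arc_starts a C = {}"
  have pred: "\<exists>y\<in>C. y \<noteq> x \<and> frac (x - y) \<le> a" if "x \<in> C" for x
    using empty that by (force simp: arc_starts_def)
  have mC: "Min C \<in> C" using assms by auto
  have "\<exists>y\<in>C. y < x \<and> x - y \<le> a" if x: "x \<in> C" "x \<noteq> Min C" for x
  proof -
    obtain y where y: "y \<in> C" "y \<noteq> x" "frac (x - y) \<le> a" using pred[OF x(1)] by blast
    have c: "x \<in> circle" "y \<in> circle" "Min C \<in> circle" using x y mC assms(3) by blast+
    have "Min C < x" using x assms by (metis Min_le order_less_le)
    show ?thesis
    proof (cases "y < x")
      case True
      then show ?thesis using y c by (auto simp: frac_diff_circle)
    next
      case False
      \<comment> \<open>The point behind \<open>x\<close> lies across 0, so the short arc from it to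
        \<open>x\<close> contains \<open>Min C\<close>, which may take its place.\<close>
      then have "x - Min C \<le> a" using y c by (auto simp: frac_diff_circle circle_def)
      then show ?thesis using \<open>Min C < x\<close> mC by blast
    qed
  qed
  then have "Max C - Min C \<le> (real (card C) - 1) * a"
    by (rule spread_upper_bound[OF assms(1,2)])
  moreover obtain y where y: "y \<in> C" "y \<noteq> Min C" "frac (Min C - y) \<le> a" using pred[OF mC] by blast
  moreover have "Min C < y" using y assms by (metis Min_le order_less_le)
  moreover have "y \<le> Max C" using y assms by auto
  moreover have "y \<in> circle" "Min C \<in> circle" using y mC assms(3) by blast+
  ultimately show False
    using assms(4) by (auto simp: frac_diff_circle algebra_simps)
qed

definition arc_hull :: "real \<Rightarrow> real set \<Rightarrow> real set" where
  "arc_hull s \<sigma> = {g\<in>circle. \<exists>x\<in>\<sigma>. \<exists>y\<in>\<sigma>. frac (g - x) + frac (y - g) \<le> s}"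

definition grid :: "nat \<Rightarrow> real set" where
  "grid N = (\<lambda>j. real j / real N) ` {..<N}"

lemma finite_grid [simp]: "finite (grid N)" by (simp add: grid_def)

lemma grid_subset_circle: "grid N \<subseteq> circle"
  by (auto simp: grid_def circle_def field_simps)

lemma grid_multiple:
  assumes "i < m" "0 < k"
  shows "real i / real m \<in> grid (m * k)"
proof -
  have "real i / real m = real (i * k) / real (m * k)" "i * k < m * k" using assms by auto
  then show ?thesis unfolding grid_def by (simp only: image_eqI lessThan_iff)
qed

lemma ex_grid_before:
  assumes b: "b \<in> circle" "0 < b" and N: "0 < N"
  shows "\<exists>g\<in>grid N. g < b \<and> b - g \<le> 1 / real N \<and> (\<forall>h\<in>grid N. h < b \<longrightarrow> h \<le> g)"
proof -
  \<comment> \<open>The ceiling minus one, rather than the floor, because the grid point must lie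
    strictly before \<open>b\<close> even when \<open>b\<close> is on the grid.\<close>
  define k where "k = \<lceil>b * real N\<rceil> - 1"
  have bN: "0 < b * real N" "b * real N < real N" using b N by (auto simp: circle_def)
  have k: "0 \<le> k" "of_int k < b * real N" "b * real N \<le> of_int k + 1"
    using bN unfolding k_def by linarith+
  have lt: "nat k < N" using k bN by linarith
  let ?g = "real (nat k) / real N"
  have rk: "real (nat k) = of_int k" using k by simp
  have "?g \<in> grid N" using lt by (auto simp: grid_def)
  moreover have "?g < b"
    unfolding rk using k N by (simp add: pos_divide_less_eq)
  moreover have "b \<le> (of_int k + 1) / real N" using k N by (simp add: pos_le_divide_eq)
  then have "b - ?g \<le> 1 / real N"
    unfolding rk by (simp add: add_divide_distrib)
  moreover have "h \<le> ?g" if h: "h \<in> grid N" "h < b" for h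
  proof -
    obtain j where j: "h = real j / real N" using h by (auto simp: grid_def)
    have "real j < b * real N" using h(2) N unfolding j by (simp add: pos_divide_less_eq)
    then have "real j < of_int k + 1" using k by linarith
    then have "int j \<le> k" by linarith
    then show ?thesis unfolding j rk using N by (simp add: divide_right_mono)
  qed
  ultimately show ?thesis by blast
qed

lemma ex_grid_frac_before:
  assumes b: "b \<in> circle" and N: "2 \<le> N"
  shows "\<exists>g\<in>grid N. g \<noteq> b \<and> frac (b - g) \<le> 1 / real N"
proof (cases "b = 0")
  case True
  \<comment> \<open>Behind 0 comes the last grid point; \<open>2 \<le> N\<close> makes it different
    from 0.\<close>
  define g where "g = real (N - 1) / real N"
  have g: "g \<in> grid N" unfolding grid_def g_def by (rule imageI) (use N in auto)
  then have gc: "g \<in> circle" using grid_subset_circle by blast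
  have g_eq: "g = 1 - 1 / real N" using N by (simp add: g_def field_simps of_nat_diff)
  have pos: "0 < g" using N by (simp add: g_eq)
  have "frac (b - g) = 1 / real N"
    using frac_diff_circle[OF b gc] pos True by (simp add: g_eq)
  then show ?thesis using g pos True by (intro bexI[of _ g]) auto
next
  case False
  then have "0 < b" using b by (auto simp: circle_def)
  then obtain g where "g \<in> grid N" "g < b" "b - g \<le> 1 / real N"
    using ex_grid_before[OF b \<open>0 < b\<close>, of N] N by auto
  then show ?thesis using b grid_subset_circle by (auto simp: frac_diff_circle subset_iff intro!: bexI[of _ g])
qed

text \<open>An arc between points of \<sigma> that enters the long gap before \<open>b\<close>
  either contains the whole gap or runs around the entire circle. Both are longer than
  \<open>s\<close>, so filling short gaps leaves long ones untouched.\<close>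

lemma arc_hull_start:
  assumes \<sigma>: "\<sigma> \<subseteq> circle" and b: "b \<in> arc_starts s \<sigma>" and x: "x \<in> arc_hull s \<sigma>" "x \<noteq> b" and s: "s < 1"
  shows "s < frac (b - x)"
proof (rule ccontr)
  assume neg: "\<not> s < frac (b - x)"
  obtain p q where pq: "p \<in> \<sigma>" "q \<in> \<sigma>" "frac (x - p) + frac (q - x) \<le> s" and xc: "x \<in> circle"
    using x by (auto simp: arc_hull_def)
  have b\<sigma>: "b \<in> \<sigma>" "\<And>y. y \<in> \<sigma> \<Longrightarrow> y \<noteq> b \<Longrightarrow> s < frac (b - y)" using b by (auto simp: arc_starts_def)
  have c: "p \<in> circle" "q \<in> circle" "b \<in> circle" using pq b\<sigma> \<sigma> by auto
  have p: "p = b \<or> s < frac (b - p)" and q: "q = b \<or> s < frac (b - q)" using pq b\<sigma> by auto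
  show False
  proof (cases "q = b")
    case True
    then show False using neg p pq(3) c xc x(2) s
      by (auto simp: frac_diff_circle circle_def split: if_splits)
  next
    case False
    then have q: "s < frac (b - q)" using q by simp
    show False
      using neg p q pq(3) c xc x(2) s False
      by (cases "p = b") (auto simp: frac_diff_circle circle_def split: if_splits)
  qed
qed

lemma arc_hull_superset: "\<sigma> \<subseteq> circle \<Longrightarrow> 0 \<le> s \<Longrightarrow> \<sigma> \<subseteq> arc_hull s \<sigma>"
  by (auto simp: arc_hull_def subset_iff intro!: bexI)

lemma arc_hull_gap:
  assumes \<sigma>: "\<sigma> \<in> gap_complex s" "\<sigma> \<noteq> {}" and "s < 1" and \<tau>: "finite \<tau>" "\<tau> \<subseteq> arc_hull s \<sigma>"
  shows "\<tau> \<in> gap_complex s"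
proof -
  obtain b where b: "b \<in> arc_starts s \<sigma>" and \<sigma>c: "\<sigma> \<subseteq> circle"
    using \<sigma> by (auto simp: gap_complex_def)
  have "b \<in> circle" using b \<sigma>c by (auto simp: arc_starts_def)
  then show ?thesis
    using \<tau> assms(3) arc_hull_start[OF \<sigma>c b] by (intro gap_complexI[of _ b]) (auto simp: arc_hull_def)
qed

text \<open>The grid makes the filled gaps so dense that they contain no gap longer than \<epsilon>.
  Only the gaps of \<sigma> longer than \<open>s\<close> survive, which is what transfers the bound
  \<open>n\<close> from scale \<open>s\<close> to scale \<epsilon>.\<close>

lemma arc_starts_hull_grid_subset:
  assumes \<sigma>: "\<sigma> \<subseteq> circle" and N: "2 \<le> N" "1 / real N \<le> \<epsilon>" and s: "s < 1" "0 \<le> s"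
  shows "arc_starts \<epsilon> (arc_hull s \<sigma> \<inter> (\<sigma> \<union> grid N)) \<subseteq> arc_starts s \<sigma>"
proof
  let ?V = "arc_hull s \<sigma> \<inter> (\<sigma> \<union> grid N)"
  fix b assume b: "b \<in> arc_starts \<epsilon> ?V"
  then have bV: "b \<in> ?V" and far: "\<And>x. x \<in> ?V \<Longrightarrow> x \<noteq> b \<Longrightarrow> \<epsilon> < frac (b - x)"
    by (auto simp: arc_starts_def)
  have bc: "b \<in> circle" using bV by (auto simp: arc_hull_def)
  have False if pq: "p \<in> \<sigma>" "q \<in> \<sigma>" "p \<noteq> b" "frac (b - p) + frac (q - b) \<le> s" for p q
  proof -
    have c: "p \<in> circle" "q \<in> circle" using pq \<sigma> by auto
    \<comment> \<open>As \<open>p\<close> is in \<open>?V\<close>, it is more than \<epsilon> behind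
      \<open>b\<close>, so the grid point just before \<open>b\<close> lies between \<open>p\<close>
      and \<open>b\<close>, hence in the hull.\<close>
    have "p \<in> ?V" using arc_hull_superset[OF \<sigma> s(2)] pq by auto
    then have p: "\<epsilon> < frac (b - p)" using far pq by auto
    obtain g where g: "g \<in> grid N" "g \<noteq> b" "frac (b - g) \<le> 1 / real N"
      using ex_grid_frac_before[OF bc N(1)] by blast
    have gc: "g \<in> circle" using g grid_subset_circle by auto
    have "frac (b - g) < frac (b - p)" using g p N by linarith
    then have "frac (g - p) + frac (q - g) \<le> s"
      using pq(3,4) c gc bc s g(2) by (auto simp: frac_diff_circle circle_def split: if_splits)
    then have "g \<in> ?V" using g gc pq by (auto simp: arc_hull_def)
    then show False using far[of g] g N by simp
  qed
  note key = this
  have "b \<in> \<sigma>"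
  proof (rule ccontr)
    assume "b \<notin> \<sigma>"
    moreover obtain p q where "p \<in> \<sigma>" "q \<in> \<sigma>" "frac (b - p) + frac (q - b) \<le> s"
      using bV by (auto simp: arc_hull_def)
    ultimately show False using key by blast
  qed
  moreover have "s < frac (b - x)" if "x \<in> \<sigma>" "x \<noteq> b" for x
    using key[OF that(1) \<open>b \<in> \<sigma>\<close> that(2)] by fastforce
  ultimately show "b \<in> arc_starts s \<sigma>" by (auto simp: arc_starts_def)
qed

text \<open>At most \<open>n\<close> arc ends leave a gap longer than \<open>s + \<epsilon>\<close>
  between two of them, of which the arc at its back end covers no more than \<epsilon>.\<close>

lemma arc_cover_subset_gap:
  assumes "real n * (s + \<epsilon>) < 1" "0 \<le> \<epsilon>" "0 \<le> s" "1 \<le> n"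
  shows "arc_cover_complex n \<epsilon> \<subseteq> gap_complex s"
proof
  fix \<sigma> assume "\<sigma> \<in> arc_cover_complex n \<epsilon>"
  then obtain C where \<sigma>: "finite \<sigma>" "\<sigma> \<subseteq> circle" and C: "finite C" "C \<subseteq> circle" "card C \<le> n"
    and cov: "\<And>x. x \<in> \<sigma> \<Longrightarrow> \<exists>c\<in>C. frac (x - c) \<le> \<epsilon>"
    by (elim arc_cover_complexE) (rule that)
  show "\<sigma> \<in> gap_complex s"
  proof (cases "\<sigma> = {}")
    case True
    then show ?thesis by (simp add: gap_complex_def)
  next
    case False
    \<comment> \<open>Each arc in use is restarted at the first point of \<sigma> it meets; the arc
      of the same length from there still covers its share of \<sigma>.\<close>
    define D where "D = {c\<in>C. \<exists>x\<in>\<sigma>. frac (x - c) \<le> \<epsilon>}"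
    have "\<exists>x. x \<in> \<sigma> \<and> (\<forall>y\<in>\<sigma>. frac (x - c) \<le> frac (y - c))" for c
      using finite_obtain_arg_min[OF \<sigma>(1) False, of "\<lambda>x. frac (x - c)"] by metis
    then obtain f where f: "\<And>c. f c \<in> \<sigma>" "\<And>c y. y \<in> \<sigma> \<Longrightarrow> frac (f c - c) \<le> frac (y - c)"
      by metis
    let ?E = "f ` D"
    have E: "finite ?E" "?E \<subseteq> \<sigma>" "card ?E \<le> n"
    proof -
      have fin: "finite D" "D \<subseteq> C" using C by (auto simp: D_def)
      then have "card ?E \<le> card D" "card D \<le> card C" using card_image_le card_mono C by auto
      then show "card ?E \<le> n" using C by simp
      show "finite ?E" "?E \<subseteq> \<sigma>" using fin f by auto
    qed
    have covE: "\<exists>e\<in>?E. frac (x - e) \<le> \<epsilon>" if x: "x \<in> \<sigma>" for x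
    proof -
      obtain c where c: "c \<in> C" "frac (x - c) \<le> \<epsilon>" using cov[OF x] by blast
      have "frac (x - f c) \<le> \<epsilon>"
      proof -
        have "x \<in> circle" "c \<in> circle" "f c \<in> circle" using x c C \<sigma> f by auto
        then show ?thesis
          using c(2) f(2)[OF x, of c] by (auto simp: frac_diff_circle circle_def split: if_splits)
      qed
      moreover have "c \<in> D" using c x by (auto simp: D_def)
      ultimately show ?thesis by blast
    qed
    have "?E \<noteq> {}" using covE False by blast
    moreover have "real (card ?E) * (s + \<epsilon>) \<le> real n * (s + \<epsilon>)"
      using E assms by (intro mult_right_mono) auto
    ultimately have "arc_starts (s + \<epsilon>) ?E \<noteq> {}"
      using E \<sigma> assms by (intro arc_starts_nonempty) auto
    then obtain b where b: "b \<in> ?E" "\<And>e. e \<in> ?E \<Longrightarrow> e \<noteq> b \<Longrightarrow> s + \<epsilon> < frac (b - e)"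
      by (auto simp: arc_starts_def)
    have s1: "s + \<epsilon> < 1"
    proof -
      have "1 * (s + \<epsilon>) \<le> real n * (s + \<epsilon>)" using assms by (intro mult_right_mono) auto
      then show ?thesis using assms by simp
    qed
    have bc: "b \<in> circle" using b E \<sigma> by auto
    show ?thesis
    proof (rule gap_complexI[OF \<sigma> bc])
      fix x assume x: "x \<in> \<sigma>" "x \<noteq> b"
      obtain e where e: "e \<in> ?E" "frac (x - e) \<le> \<epsilon>" using covE[OF x(1)] by blast
      have c: "x \<in> circle" "e \<in> circle" using x e E \<sigma> by auto
      show "s < frac (b - x)"
      proof (cases "e = b")
        case True
        then show ?thesis using e(2) s1 c bc x(2) by (auto simp: frac_diff_circle circle_def split: if_splits)
      next
        case False
        then have "s + \<epsilon> < frac (b - e)" using b e by blast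
        then show ?thesis
          using e(2) s1 c bc x(2) by (auto simp: frac_diff_circle circle_def split: if_splits)
      qed
    qed (use s1 assms in auto)
  qed
qed

text \<open>The mesh is made small along multiples of \<open>m\<close>, so that the endpoints of the
  \<open>m\<close> cells are grid points.\<close>

lemma ex_grid_size:
  assumes "0 < \<epsilon>" "0 < m"
  obtains k where "2 \<le> k" "1 / real (m * k) \<le> \<epsilon>"
proof -
  obtain k :: nat where k: "1 / \<epsilon> < real k" using reals_Archimedean2 by blast
  have "real k \<le> real (m * (k + 2))" using assms
    by (metis le_add1 mult.commute mult_le_mono nat_mult_1 of_nat_mono order_trans Suc_leI One_nat_def)
  then have "1 / \<epsilon> \<le> real (m * (k + 2))" using k by linarith
  moreover have pos: "0 < real (m * (k + 2))" using assms by (simp only: of_nat_0_less_iff) simp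
  ultimately have "1 / real (m * (k + 2)) \<le> \<epsilon>"
    by (simp only: pos_divide_le_eq[OF pos] pos_divide_le_eq[OF assms(1)] mult.commute)
  then show ?thesis using that[of "k + 2"] by simp
qed

text \<open>The bound \<open>1 \<le> (real n + 1) * s\<close> limits the starts in a carrier to
  \<open>n\<close>; \<open>\<epsilon> \<le> s\<close> keeps a gap longer than \<open>s\<close>
  visible at scale \<epsilon>, so that a start exists; \<open>real n * (s + \<epsilon>) < 1\<close>
  gives the inclusion of complexes.\<close>

proposition homotopy_equivalence_arc_cover_gap:
  assumes s: "0 < s" "1 \<le> (real n + 1) * s" and \<epsilon>: "0 < \<epsilon>" "\<epsilon> \<le> s" "real n * (s + \<epsilon>) < 1" and n: "1 \<le> n"
  shows "homotopy_equivalence_map (realization (arc_cover_complex n \<epsilon>)) (realization (gap_complex s)) id"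
proof -
  obtain N where N: "2 \<le> N" "1 / real N \<le> \<epsilon>"
    using ex_grid_size[OF \<epsilon>(1), of 1] by auto
  have "1 * (s + \<epsilon>) \<le> real n * (s + \<epsilon>)" using s \<epsilon> n by (intro mult_right_mono) auto
  then have "s + \<epsilon> < 1" using \<epsilon>(3) unfolding mult_1 by (rule order_le_less_trans)
  then have s1: "s < 1" using \<epsilon> by simp
  \<comment> \<open>The hull is sampled on \<sigma> and on one grid for all \<sigma>, so the carrier
    is finite and monotone.\<close>
  define V where "V \<sigma> = arc_hull s \<sigma> \<inter> (\<sigma> \<union> grid N)" for \<sigma>
  have main: "\<sigma> \<subseteq> V \<sigma>" "V \<sigma> \<in> gap_complex s"
    "contractible_space (realization (full_subcomplex (arc_cover_complex n \<epsilon>) (V \<sigma>)))"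
    if \<sigma>: "\<sigma> \<in> gap_complex s" "\<sigma> \<noteq> {}" for \<sigma>
  proof -
    have fin: "finite \<sigma>" "\<sigma> \<subseteq> circle" using \<sigma> by (auto simp: gap_complex_def)
    show sub: "\<sigma> \<subseteq> V \<sigma>" using arc_hull_superset[of \<sigma> s] fin s by (auto simp: V_def)
    have finV: "finite (V \<sigma>)" "V \<sigma> \<subseteq> arc_hull s \<sigma>" using fin by (auto simp: V_def)
    then show "V \<sigma> \<in> gap_complex s" using arc_hull_gap[OF \<sigma> s1] by blast
    obtain b where b: "b \<in> arc_starts s \<sigma>" using \<sigma> by (auto simp: gap_complex_def)
    have "b \<in> V \<sigma>" using b sub by (auto simp: arc_starts_def)
    moreover have "\<epsilon> < frac (b - x)" if "x \<in> V \<sigma>" "x \<noteq> b" for x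
    proof -
      have "x \<in> arc_hull s \<sigma>" using that finV by auto
      then show ?thesis using arc_hull_start[OF fin(2) b _ that(2) s1] \<epsilon> by linarith
    qed
    ultimately have ne: "arc_starts \<epsilon> (V \<sigma>) \<noteq> {}" by (auto simp: arc_starts_def)
    have "arc_starts \<epsilon> (V \<sigma>) \<subseteq> arc_starts s \<sigma>"
      unfolding V_def using arc_starts_hull_grid_subset[OF fin(2) N s1] s by simp
    moreover have "finite (arc_starts s \<sigma>)" using fin by (auto simp: arc_starts_def)
    ultimately have "card (arc_starts \<epsilon> (V \<sigma>)) \<le> n"
      using card_mono card_arc_starts_le[OF fin s(2) n] order_trans by blast
    then show "contractible_space (realization (full_subcomplex (arc_cover_complex n \<epsilon>) (V \<sigma>)))"
      using contractible_arc_cover[OF finV(1) _ ne] finV(2) \<epsilon> by (auto simp: arc_hull_def)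
  qed
  show ?thesis
  proof (rule homotopy_equivalence_subcomplex[where V = V])
    show "arc_cover_complex n \<epsilon> \<subseteq> gap_complex s"
      using arc_cover_subset_gap[OF \<epsilon>(3)] \<epsilon> s n by simp
    fix \<sigma> assume \<sigma>: "\<sigma> \<in> gap_complex s" "\<sigma> \<noteq> {}"
    then obtain v where "v \<in> \<sigma>" by blast
    then have v: "v \<in> V \<sigma>" "v \<in> circle" using main(1)[OF \<sigma>] \<sigma> by (auto simp: gap_complex_def)
    have "{v} \<in> full_subcomplex (arc_cover_complex n \<epsilon>) (V \<sigma>)"
      using v n \<epsilon> by (auto simp: full_subcomplex_def intro!: arc_cover_complexI[where C = "{v}"])
    then show "realization_set (full_subcomplex (arc_cover_complex n \<epsilon>) (V \<sigma>)) \<noteq> {}"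
      by (rule realization_set_nonempty)
  qed (use main abstract_complex_gap[OF s1] abstract_complex_arc_cover in \<open>auto simp: V_def arc_hull_def\<close>)
qed

section \<open>Sets missing a cell\<close>

definition cell :: "nat \<Rightarrow> real \<Rightarrow> nat" where
  "cell m x = nat \<lfloor>real m * x\<rfloor>"

lemma cell_eq_iff:
  assumes "x \<in> circle"
  shows "cell m x = i \<longleftrightarrow> real i \<le> real m * x \<and> real m * x < real i + 1"
proof -
  have "0 \<le> real m * x" using assms by (simp add: circle_def)
  then have "cell m x = i \<longleftrightarrow> \<lfloor>real m * x\<rfloor> = int i" unfolding cell_def by auto
  also have "\<dots> \<longleftrightarrow> real i \<le> real m * x \<and> real m * x < real i + 1" by (simp add: floor_eq_iff)
  finally show ?thesis .
qed

lemma cell_bounds: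
  assumes "x \<in> circle"
  shows "real (cell m x) \<le> real m * x" "real m * x < real (cell m x) + 1"
  using cell_eq_iff[OF assms, of m "cell m x"] by auto

lemma cell_less:
  assumes "x \<in> circle" "0 < m"
  shows "cell m x < m"
proof -
  have "real m * x < real m * 1" using assms by (intro mult_strict_left_mono) (auto simp: circle_def)
  then show ?thesis using cell_bounds(1)[OF assms(1), of m] by linarith
qed

lemma cell_grid:
  assumes "i < m"
  shows "real i / real m \<in> circle" "cell m (real i / real m) = i"
proof -
  show c: "real i / real m \<in> circle" using assms by (auto simp: circle_def)
  show "cell m (real i / real m) = i" using assms by (subst cell_eq_iff[OF c]) auto
qed

lemma cell_frac_near:
  assumes c: "x \<in> circle" "y \<in> circle" and m: "0 < m" and near: "real m * frac (x - y) < 1"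
  shows "cell m x = cell m y \<or> cell m x = Suc (cell m y) mod m"
proof (cases "y \<le> x")
  case True
  then have "real m * x - real m * y < 1" "real m * y \<le> real m * x"
    using near c by (auto simp: frac_diff_circle right_diff_distrib intro: mult_left_mono)
  then have "cell m x = cell m y \<or> cell m x = Suc (cell m y)"
    using cell_bounds[OF c(1), of m] cell_bounds[OF c(2), of m] by linarith
  then show ?thesis using cell_less[OF c(1) m] by auto
next
  case False
  then have n: "real m * x - real m * y + real m < 1"
    using near c by (auto simp: frac_diff_circle algebra_simps)
  moreover have "real m * y < real m * 1" "0 \<le> real m * x"
    using c m by (auto simp: circle_def)
  ultimately have "cell m x = 0" "Suc (cell m y) = m"
    using cell_bounds[OF c(1), of m] cell_bounds[OF c(2), of m] cell_less[OF c(2) m] by linarith+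
  then show ?thesis by simp
qed

definition cell_complex :: "nat \<Rightarrow> real set set" where
  "cell_complex m = {\<sigma>. finite \<sigma> \<and> \<sigma> \<subseteq> circle \<and> cell m ` \<sigma> \<noteq> {..<m}}"

lemma cells_subset:
  assumes "\<sigma> \<subseteq> circle" "0 < m"
  shows "cell m ` \<sigma> \<subseteq> {..<m}"
  using assms cell_less by auto

lemma abstract_complex_cell:
  assumes "0 < m"
  shows "abstract_complex (cell_complex m)"
  unfolding abstract_complex_def
proof (intro ballI conjI subsetI)
  fix \<sigma> \<tau> assume \<sigma>: "\<sigma> \<in> cell_complex m" "\<tau> \<in> Pow \<sigma>"
  then have c: "\<sigma> \<subseteq> circle" by (simp add: cell_complex_def)
  have "cell m ` \<tau> \<subseteq> cell m ` \<sigma>" using \<sigma> by auto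
  then show "\<tau> \<in> cell_complex m"
    using \<sigma> cells_subset[OF c assms] by (auto simp: cell_complex_def intro: finite_subset)
qed (simp add: cell_complex_def)

text \<open>A set without such an element is closed under cyclic predecessors: it descends to 0,
  passes to \<open>m - 1\<close>, and from there reaches every index.\<close>

lemma ex_cyclic_start:
  assumes S: "S \<subseteq> {..<m}" "S \<noteq> {}" "S \<noteq> {..<m}"
  obtains i where "i \<in> S" "\<And>j. j < m \<Longrightarrow> Suc j mod m = i \<Longrightarrow> j \<notin> S"
proof (rule ccontr)
  assume "\<not> thesis"
  then have step: "\<exists>j<m. Suc j mod m = i \<and> j \<in> S" if "i \<in> S" for i
    using that \<open>\<And>i. i \<in> S \<Longrightarrow> (\<And>j. j < m \<Longrightarrow> Suc j mod m = i \<Longrightarrow> j \<notin> S) \<Longrightarrow> thesis\<close> by metis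
  have down: "j \<in> S" if "i \<in> S" "j \<le> i" for i j
    using that(2,1)
  proof (induction rule: inc_induct)
    case (step n)
    then have "Suc n \<in> S" by simp
    then obtain k where k: "k < m" "Suc k mod m = Suc n" "k \<in> S" using \<open>\<And>i. i \<in> S \<Longrightarrow> \<exists>j<m. Suc j mod m = i \<and> j \<in> S\<close> by blast
    then have "k = n" by (cases "Suc k = m") auto
    then show ?case using k by simp
  qed
  obtain i where "i \<in> S" using S by auto
  then have "0 \<in> S" using down by blast
  then obtain k where k: "k < m" "Suc k mod m = 0" "k \<in> S" using step[of 0] by auto
  then have "Suc k = m" by (metis Suc_lessI mod_less nat.distinct(1))
  then have "{..<m} \<subseteq> S" using down[OF k(3)] by auto
  then show False using S by auto
qed

text \<open>The carrier for both comparisons with the cell complex: with a fine grid for the arc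
  covers, and with \<open>N = m\<close>, one point per cell, for the boundary of the
  simplex.\<close>

definition cell_fill :: "nat \<Rightarrow> nat \<Rightarrow> real set \<Rightarrow> real set" where
  "cell_fill m N \<sigma> = \<sigma> \<union> {g\<in>grid N. cell m g \<in> cell m ` \<sigma>}"

lemma cell_image_fill: "cell m ` cell_fill m N \<sigma> = cell m ` \<sigma>"
  by (auto simp: cell_fill_def)

text \<open>Inside an occupied cell the fine grid leaves no gap longer than \<epsilon>, so a start
  must be a left endpoint of a cell. If the preceding cell were occupied, its last grid point would
  lie within \<epsilon> behind that endpoint.\<close>

lemma arc_starts_cell_fill:
  assumes \<sigma>: "\<sigma> \<subseteq> circle" and m: "0 < m" and k: "2 \<le> k" "1 / real (m * k) \<le> \<epsilon>"
    and b: "b \<in> arc_starts \<epsilon> (cell_fill m (m * k) \<sigma>)"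
  shows "b = real (cell m b) / real m" "cell m b \<in> cell m ` \<sigma>"
    "\<And>j. j < m \<Longrightarrow> Suc j mod m = cell m b \<Longrightarrow> j \<notin> cell m ` \<sigma>"
proof -
  let ?N = "m * k" let ?V = "cell_fill m ?N \<sigma>" let ?i = "cell m b"
  have bV: "b \<in> ?V" and far: "\<And>x. x \<in> ?V \<Longrightarrow> x \<noteq> b \<Longrightarrow> \<epsilon> < frac (b - x)"
    using b by (auto simp: arc_starts_def)
  have bc: "b \<in> circle" using bV \<sigma> grid_subset_circle by (auto simp: cell_fill_def)
  have N: "2 \<le> ?N" "0 < ?N" using m k by (auto intro: order_trans[of 2 k])
  show iS: "?i \<in> cell m ` \<sigma>" using bV by (auto simp: cell_fill_def)
  show eq: "b = real ?i / real m"
  proof (rule ccontr)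
    assume ne: "b \<noteq> real ?i / real m"
    then have lt: "real ?i / real m < b"
      using cell_bounds(1)[OF bc, of m] m by (simp add: field_simps)
    then have "0 < b" by (metis divide_nonneg_nonneg le_less_trans of_nat_0_le_iff)
    then obtain g where g: "g \<in> grid ?N" "g < b" "b - g \<le> 1 / real ?N"
      and max: "\<And>h. h \<in> grid ?N \<Longrightarrow> h < b \<Longrightarrow> h \<le> g"
      using ex_grid_before[OF bc _ N(2)] by blast
    have im: "?i < m" using cell_less[OF bc m] .
    then have "real ?i / real m \<in> grid ?N" using grid_multiple[of ?i m k] k by simp
    then have ig: "real ?i / real m \<le> g" using max lt by blast
    have gc: "g \<in> circle" using g grid_subset_circle by auto
    have "cell m g = ?i"
      unfolding cell_eq_iff[OF gc]
    proof
      show "real ?i \<le> real m * g" using ig m by (simp add: field_simps)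
      have "real m * g < real m * b" using g m by simp
      then show "real m * g < real ?i + 1" using cell_bounds(2)[OF bc, of m] by linarith
    qed
    then have "g \<in> ?V" using g iS by (auto simp: cell_fill_def)
    moreover have "frac (b - g) = b - g" using g gc bc by (simp add: frac_diff_circle)
    ultimately show False using far[of g] g k by force
  qed
  fix j assume j: "j < m" "Suc j mod m = ?i"
  \<comment> \<open>The last of the \<open>k\<close> grid points in cell \<open>j\<close>, one mesh
    width before the left endpoint of the next cell.\<close>
  define g where "g = real (j * k + (k - 1)) / real ?N"
  have jk: "j * k + (k - 1) < ?N"
  proof -
    have "j * k + (k - 1) < Suc j * k" using k by simp
    also have "\<dots> \<le> m * k" using j by (intro mult_le_mono1) simp
    finally show ?thesis .
  qed
  have g: "g \<in> grid ?N" unfolding g_def grid_def using jk by (intro imageI) simp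
  have gc: "g \<in> circle" using g grid_subset_circle by auto
  have mg: "real m * g = real j + 1 - 1 / real k"
    unfolding g_def using m k by (simp add: field_simps of_nat_diff)
  have cg: "cell m g = j" unfolding cell_eq_iff[OF gc] mg using k by (auto simp: field_simps)
  have mb: "real m * b = real ?i" using eq m by (metis nonzero_mult_div_cancel_left of_nat_0_less_iff order_less_irrefl times_divide_eq_right)
  have "real m * frac (b - g) = 1 / real k \<and> g \<noteq> b"
  proof (cases "Suc j = m")
    case True
    then have "?i = 0" using j by simp
    then have b0: "b = 0" using eq by simp
    have "1 / real k < 1" using k by simp
    then have "0 < real m * g" unfolding mg by linarith
    then have "0 < g" using m by (simp add: zero_less_mult_iff)
    then have "frac (b - g) = 1 - g" "g \<noteq> b" using frac_diff_circle[OF bc gc] b0 by auto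
    then show ?thesis using mg True by (simp add: right_diff_distrib)
  next
    case False
    then have i: "?i = Suc j" using j by simp
    have "real m * g < real m * b" unfolding mg mb i using k by simp
    then have "g < b" using m by simp
    then have "frac (b - g) = b - g" using frac_diff_circle[OF bc gc] by simp
    then show ?thesis using mg mb i \<open>g < b\<close> by (simp add: right_diff_distrib)
  qed
  then have "frac (b - g) = 1 / real ?N" "g \<noteq> b" using m k by (auto simp: field_simps)
  then have "g \<notin> ?V" using far[of g] k by auto
  then show "j \<notin> cell m ` \<sigma>" using g cg by (auto simp: cell_fill_def)
qed

text \<open>A start determines an occupied cell, its own, and an empty cell, the one before it. Both
  assignments are injective, so twice the number of starts is at most \<open>2 * n + 1\<close>, and
  by parity there are at most \<open>n\<close>.\<close>

lemma contractible_arc_cover_cell_fill: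
  assumes \<sigma>: "\<sigma> \<in> cell_complex (2 * n + 1)" "\<sigma> \<noteq> {}"
    and k: "2 \<le> k" "1 / real ((2 * n + 1) * k) \<le> \<epsilon>" and \<epsilon>: "0 < \<epsilon>" "real (2 * n + 1) * \<epsilon> < 1"
  shows "contractible_space (realization
    (full_subcomplex (arc_cover_complex n \<epsilon>) (cell_fill (2 * n + 1) ((2 * n + 1) * k) \<sigma>)))"
proof -
  define m where "m = 2 * n + 1"
  have m: "0 < m" by (simp add: m_def)
  let ?V = "cell_fill m (m * k) \<sigma>"
  let ?S = "cell m ` \<sigma>"
  have fin: "finite \<sigma>" "\<sigma> \<subseteq> circle" and S: "?S \<noteq> {..<m}" "?S \<noteq> {}"
    using \<sigma> by (auto simp: cell_complex_def m_def)
  have Sm: "?S \<subseteq> {..<m}" by (rule cells_subset[OF fin(2) m])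
  have V: "finite ?V" "?V \<subseteq> circle" using fin grid_subset_circle by (auto simp: cell_fill_def)
  note k' = k[folded m_def] and \<epsilon>' = \<epsilon>(2)[folded m_def]
  note st = arc_starts_cell_fill[OF fin(2) m k']
  let ?A = "arc_starts \<epsilon> ?V"
  have "inj_on (cell m) ?A"
    by (rule inj_onI) (metis st(1))
  then have cA: "card ?A = card (cell m ` ?A)" by (simp add: card_image)
  have finS: "finite ?S" using fin by simp
  have "cell m ` ?A \<subseteq> ?S" using st(2) by blast
  then have le1: "card ?A \<le> card ?S" unfolding cA by (intro card_mono finS)
  \<comment> \<open>The cyclic predecessor, which sends the cells of starts injectively to empty
    cells.\<close>
  define p where "p i = (if i = 0 then m - 1 else i - 1)" for i
  have p: "p i < m" "Suc (p i) mod m = i" if "i < m" for i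
    using that m by (auto simp: p_def)
  have "p ` cell m ` ?A \<subseteq> {..<m} - ?S"
  proof clarify
    fix b assume b: "b \<in> ?A"
    then have i: "cell m b < m" using st(2) Sm by blast
    show "p (cell m b) \<in> {..<m} - ?S" using p[OF i] st(3)[OF b] by auto
  qed
  moreover have "inj_on p (cell m ` ?A)"
  proof (rule inj_onI)
    fix i j assume "i \<in> cell m ` ?A" "j \<in> cell m ` ?A" and "p i = p j"
    moreover from this have "i < m" "j < m" using st(2) Sm by blast+
    ultimately show "i = j" using p(2) by metis
  qed
  ultimately have "card ?A \<le> card ({..<m} - ?S)"
    unfolding cA by (metis card_image card_mono finite_Diff finite_lessThan)
  also have "\<dots> = m - card ?S" using Sm finS by (simp add: card_Diff_subset)
  finally have "card ?A \<le> n" using le1 unfolding m_def by linarith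
  moreover have "?A \<noteq> {}"
  proof -
    obtain i where i: "i \<in> ?S" "\<And>j. j < m \<Longrightarrow> Suc j mod m = i \<Longrightarrow> j \<notin> ?S"
      using ex_cyclic_start[OF Sm S(2,1)] by blast
    have im: "i < m" using i Sm by auto
    let ?b = "real i / real m"
    have bc: "?b \<in> circle" "cell m ?b = i" using cell_grid[OF im] by auto
    have "?b \<in> grid (m * k)" using grid_multiple[OF im, of k] k by simp
    then have bV: "?b \<in> ?V" using bc i by (auto simp: cell_fill_def)
    \<comment> \<open>A point within \<epsilon> behind \<open>?b\<close> is in the same cell or in
      the preceding one, which is empty. In the same cell it lies ahead of the left endpoint
      \<open>?b\<close>, so the arc from it to \<open>?b\<close> goes around all the other cells.
      That is short enough only for \<open>m = 1\<close>, when the occupied cell is the only one and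
      \<sigma> misses none.\<close>
    have "\<epsilon> < frac (?b - x)" if x: "x \<in> ?V" "x \<noteq> ?b" for x
    proof (rule ccontr)
      assume neg: "\<not> \<epsilon> < frac (?b - x)"
      have xc: "x \<in> circle" using x V by auto
      have xS: "cell m x \<in> ?S" using x cell_image_fill[of m "m * k" \<sigma>] by blast
      have "real m * frac (?b - x) \<le> real m * \<epsilon>" using neg by (intro mult_left_mono) auto
      then have "real m * frac (?b - x) < 1" using \<epsilon>' by linarith
      then have "cell m ?b = cell m x \<or> cell m ?b = Suc (cell m x) mod m"
        by (rule cell_frac_near[OF bc(1) xc m])
      moreover have "cell m ?b \<noteq> Suc (cell m x) mod m"
        using i(2)[OF cell_less[OF xc m]] xS bc(2) by auto
      ultimately have "cell m x = i" using bc by simp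
      then have "i \<le> real m * x" using cell_bounds(1)[OF xc, of m] by simp
      then have "?b < x" using m x(2) by (simp add: field_simps)
      then have "frac (?b - x) = ?b - x + 1" using frac_diff_circle[OF bc(1) xc] by simp
      then have "real m * frac (?b - x) = real i - real m * x + real m"
        using m by (simp add: field_simps)
      moreover have "real m * x < real i + 1" using cell_bounds(2)[OF xc, of m] \<open>cell m x = i\<close> by simp
      ultimately have "real m < 2" using \<open>real m * frac (?b - x) < 1\<close> by linarith
      then have "m = 1" using m by simp
      then have "?S = {..<m}" using Sm i(1) im by (intro subset_antisym) auto
      then show False using S by simp
    qed
    then have "?b \<in> ?A" using bV by (auto simp: arc_starts_def)
    then show ?thesis by blast
  qed
  ultimately show ?thesis
    using contractible_arc_cover[OF V] \<epsilon> unfolding m_def by simp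
qed

text \<open>An arc shorter than a cell meets at most the cell of its initial point and the next one,
  so \<open>n\<close> arcs meet at most \<open>2 * n\<close> cells.\<close>

lemma arc_cover_subset_cell:
  assumes "0 \<le> \<epsilon>" "real (2 * n + 1) * \<epsilon> < 1"
  shows "arc_cover_complex n \<epsilon> \<subseteq> cell_complex (2 * n + 1)"
proof
  let ?m = "2 * n + 1"
  fix \<sigma> assume "\<sigma> \<in> arc_cover_complex n \<epsilon>"
  then obtain C where \<sigma>: "finite \<sigma>" "\<sigma> \<subseteq> circle" and C: "finite C" "C \<subseteq> circle" "card C \<le> n"
    and cov: "\<And>x. x \<in> \<sigma> \<Longrightarrow> \<exists>c\<in>C. frac (x - c) \<le> \<epsilon>"
    by (elim arc_cover_complexE) (rule that)
  let ?D = "cell ?m ` C \<union> (\<lambda>c. Suc (cell ?m c) mod ?m) ` C"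
  have "cell ?m ` \<sigma> \<subseteq> ?D"
  proof clarify
    fix x assume x: "x \<in> \<sigma>" and n: "cell ?m x \<notin> (\<lambda>c. Suc (cell ?m c) mod ?m) ` C"
    obtain c where c: "c \<in> C" "frac (x - c) \<le> \<epsilon>" using cov[OF x] by blast
    have "real ?m * frac (x - c) \<le> real ?m * \<epsilon>" using c by (intro mult_left_mono) auto
    then have near: "real ?m * frac (x - c) < 1" using assms by linarith
    have "x \<in> circle" "c \<in> circle" using x c \<sigma> C by auto
    then have "cell ?m x = cell ?m c \<or> cell ?m x = Suc (cell ?m c) mod ?m"
      by (rule cell_frac_near[OF _ _ _ near]) simp
    then show "cell ?m x \<in> cell ?m ` C" using n c(1) by blast
  qed
  moreover have "card ?D \<le> card C + card C"
    by (rule order_trans[OF card_Un_le add_mono[OF card_image_le card_image_le]]) (use C in auto)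
  ultimately have "card (cell ?m ` \<sigma>) \<le> 2 * n"
    using card_mono[of ?D "cell ?m ` \<sigma>"] C by auto
  then have "cell ?m ` \<sigma> \<noteq> {..<?m}" by (metis card_lessThan not_less_eq_eq le_refl add.commute plus_1_eq_Suc)
  then show "\<sigma> \<in> cell_complex ?m" using \<sigma> by (simp add: cell_complex_def)
qed

proposition homotopy_equivalence_arc_cover_cell:
  assumes \<epsilon>: "0 < \<epsilon>" "real (2 * n + 1) * \<epsilon> < 1" and n: "1 \<le> n"
  shows "homotopy_equivalence_map (realization (arc_cover_complex n \<epsilon>))
    (realization (cell_complex (2 * n + 1))) id"
proof -
  let ?m = "2 * n + 1"
  obtain k where k: "2 \<le> k" "1 / real (?m * k) \<le> \<epsilon>" using ex_grid_size[OF \<epsilon>(1), of ?m] by auto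
  let ?V = "cell_fill ?m (?m * k)"
  show ?thesis
  proof (rule homotopy_equivalence_subcomplex[where V = ?V])
    show "arc_cover_complex n \<epsilon> \<subseteq> cell_complex ?m" using arc_cover_subset_cell[OF _ \<epsilon>(2)] \<epsilon> by simp
    show "?V \<sigma> \<subseteq> ?V \<tau>" if "\<sigma> \<subseteq> \<tau>" for \<sigma> \<tau>
      using that image_mono[OF that, of "cell ?m"] unfolding cell_fill_def by blast
    fix \<sigma> assume \<sigma>: "\<sigma> \<in> cell_complex ?m" "\<sigma> \<noteq> {}"
    have fin: "finite \<sigma>" "\<sigma> \<subseteq> circle" "cell ?m ` \<sigma> \<noteq> {..<?m}" using \<sigma> by (auto simp: cell_complex_def)
    have "finite (?V \<sigma>)" "?V \<sigma> \<subseteq> circle"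
      using fin grid_subset_circle by (auto simp: cell_fill_def)
    then have "?V \<sigma> \<in> cell_complex ?m"
      using fin(3) by (simp add: cell_complex_def cell_image_fill)
    then show "\<sigma> \<subseteq> ?V \<sigma> \<and> ?V \<sigma> \<in> cell_complex ?m" by (simp add: cell_fill_def)
    show "contractible_space (realization (full_subcomplex (arc_cover_complex n \<epsilon>) (?V \<sigma>)))"
      by (rule contractible_arc_cover_cell_fill[OF \<sigma> k \<epsilon>])
    obtain v where "v \<in> \<sigma>" using \<sigma> by blast
    then have "v \<in> ?V \<sigma>" "v \<in> circle" using fin by (auto simp: cell_fill_def)
    then have "{v} \<in> full_subcomplex (arc_cover_complex n \<epsilon>) (?V \<sigma>)"
      using n \<epsilon> by (auto simp: full_subcomplex_def intro!: arc_cover_complexI[where C = "{v}"])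
    then show "realization_set (full_subcomplex (arc_cover_complex n \<epsilon>) (?V \<sigma>)) \<noteq> {}"
      by (rule realization_set_nonempty)
  qed (auto intro: abstract_complex_cell abstract_complex_arc_cover)
qed

section \<open>The boundary of a simplex inside the cell complex\<close>

definition boundary_complex :: "'a set \<Rightarrow> 'a set set" where
  "boundary_complex A = {\<sigma>. \<sigma> \<subset> A}"

lemma abstract_complex_boundary: "finite A \<Longrightarrow> abstract_complex (boundary_complex A)"
  unfolding abstract_complex_def boundary_complex_def by (auto intro: finite_subset)

lemma cell_image_grid: "cell m ` grid m = {..<m}"
proof -
  have "cell m ` grid m = (\<lambda>i. cell m (real i / real m)) ` {..<m}"
    by (simp add: grid_def image_image)
  also have "\<dots> = (\<lambda>i. i) ` {..<m}" by (rule image_cong) (auto simp: cell_grid)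
  finally show ?thesis by simp
qed

lemma inj_on_cell_grid: "inj_on (cell m) (grid m)"
  by (rule inj_onI) (auto simp: grid_def cell_grid)

text \<open>Adding to a face the left endpoints of its occupied cells gives a carrier whose grid
  points are exactly those endpoints. They omit at least one grid point, so they span a full simplex
  of the boundary.\<close>

proposition homotopy_equivalence_boundary_cell:
  assumes m: "0 < m"
  shows "homotopy_equivalence_map (realization (boundary_complex (grid m))) (realization (cell_complex m)) id"
proof (rule homotopy_equivalence_subcomplex[where V = "cell_fill m m"])
  let ?V = "cell_fill m m"
  show "boundary_complex (grid m) \<subseteq> cell_complex m"
  proof
    fix \<sigma> assume "\<sigma> \<in> boundary_complex (grid m)"
    then have \<sigma>: "\<sigma> \<subseteq> grid m" "\<sigma> \<noteq> grid m" by (auto simp: boundary_complex_def)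
    then have "cell m ` \<sigma> \<noteq> cell m ` grid m"
      using inj_on_image_eq_iff[OF inj_on_cell_grid, of \<sigma> m "grid m"] by blast
    then show "\<sigma> \<in> cell_complex m"
      using \<sigma>(1) finite_subset[OF \<sigma>(1)] grid_subset_circle by (auto simp: cell_complex_def cell_image_grid)
  qed
  show "?V \<sigma> \<subseteq> ?V \<tau>" if "\<sigma> \<subseteq> \<tau>" for \<sigma> \<tau>
    using that image_mono[OF that, of "cell m"] unfolding cell_fill_def by blast
  fix \<sigma> assume \<sigma>: "\<sigma> \<in> cell_complex m" "\<sigma> \<noteq> {}"
  have fin: "finite \<sigma>" "\<sigma> \<subseteq> circle" "cell m ` \<sigma> \<noteq> {..<m}" using \<sigma> by (auto simp: cell_complex_def)
  have "finite (?V \<sigma>)" "?V \<sigma> \<subseteq> circle"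
    using fin grid_subset_circle by (auto simp: cell_fill_def)
  then have "?V \<sigma> \<in> cell_complex m"
    using fin(3) by (simp add: cell_complex_def cell_image_fill)
  then show "\<sigma> \<subseteq> ?V \<sigma> \<and> ?V \<sigma> \<in> cell_complex m" by (simp add: cell_fill_def)
  define Q where "Q = {g\<in>grid m. cell m g \<in> cell m ` \<sigma>}"
  have "cell m ` Q \<subseteq> cell m ` \<sigma>" by (auto simp: Q_def)
  then have Qne: "Q \<noteq> grid m"
    using cell_image_grid[of m] cells_subset[OF fin(2) m] fin(3) by auto
  have "\<tau> \<subset> grid m \<and> \<tau> \<subseteq> ?V \<sigma> \<longleftrightarrow> \<tau> \<subseteq> Q" for \<tau>
    using Qne by (auto simp: Q_def cell_fill_def)
  then have full: "full_subcomplex (boundary_complex (grid m)) (?V \<sigma>) = Pow Q"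
    by (auto simp: full_subcomplex_def boundary_complex_def)
  obtain x where x: "x \<in> \<sigma>" using \<sigma> by blast
  then have i: "cell m x < m" using fin cell_less m by blast
  then have v: "real (cell m x) / real m \<in> Q"
    using x cell_grid[OF i] by (auto simp: Q_def grid_def)
  show "contractible_space (realization (full_subcomplex (boundary_complex (grid m)) (?V \<sigma>)))"
    unfolding full using v by (intro contractible_space_simplex) (auto simp: Q_def)
  show "realization_set (full_subcomplex (boundary_complex (grid m)) (?V \<sigma>)) \<noteq> {}"
    unfolding full using v by (intro realization_set_nonempty) auto
qed (use m in \<open>auto intro: abstract_complex_cell abstract_complex_boundary\<close>)

lemma closed_geom_simplex: "closed (geom_simplex \<sigma>)"
proof -
  have "geom_simplex \<sigma> = (\<Inter>v. {x. 0 \<le> x v}) \<inter> (\<Inter>v\<in>-\<sigma>. {x. x v = 0}) \<inter> {x. sum x \<sigma> = 1}"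
    by (auto simp: geom_simplex_def)
  moreover have "continuous_on UNIV (\<lambda>x::'a \<Rightarrow> real. sum x \<sigma>)"
    by (intro continuous_on_sum continuous_on_product_coordinates)
  ultimately show ?thesis
    by (auto intro!: closed_Int closed_INT closed_Collect_le closed_Collect_eq continuous_on_const)
qed

text \<open>Finitely many closed simplices paste, so the weak topology is the subspace topology.
  This makes the boundary complex comparable with the sphere, which is defined as a
  subspace.\<close>

lemma realization_finite:
  assumes fin: "finite K" "\<And>\<sigma>. \<sigma> \<in> K \<Longrightarrow> finite \<sigma>"
  shows "realization K = top_of_set (realization_set K)"
proof -
  let ?X = "top_of_set (realization_set K)"
  have "continuous_map ?X (realization K) id"
  proof (rule pasting_lemma_closed[where I = K and T = geom_simplex and f = "\<lambda>\<sigma>. id"])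
    fix \<sigma> assume \<sigma>: "\<sigma> \<in> K"
    note sub = geom_simplex_subset_realization[OF \<sigma> fin(2)[OF \<sigma>]]
    show "closedin ?X (geom_simplex \<sigma>)"
      using closed_geom_simplex sub by (rule closed_subset[rotated])
    have "subtopology ?X (geom_simplex \<sigma>) = simplex_topology \<sigma>"
      using sub by (simp add: subtopology_subtopology Int_absorb1 powertop_real_eq_euclidean)
    then show "continuous_map (subtopology ?X (geom_simplex \<sigma>)) (realization K) id"
      using continuous_map_into_realization[OF continuous_map_id \<sigma> fin(2)[OF \<sigma>]] by simp
  qed (use fin in \<open>auto simp: realization_set_def\<close>)
  moreover have "continuous_map (realization K) ?X id"
    using continuous_map_realization_powertop[of K]
    by (simp add: continuous_map_in_subtopology powertop_real_eq_euclidean)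
  ultimately have "homeomorphic_maps ?X (realization K) id id"
    by (simp add: homeomorphic_maps_def)
  then show ?thesis by (metis homeomorphic_maps_id)
qed

lemma realization_set_boundary:
  assumes "finite A"
  shows "realization_set (boundary_complex A) = {x \<in> geom_simplex A. \<exists>a\<in>A. x a = 0}"
proof (intro set_eqI iffI)
  fix x assume "x \<in> realization_set (boundary_complex A)"
  then obtain \<sigma> where \<sigma>: "\<sigma> \<subset> A" "x \<in> geom_simplex \<sigma>" by (auto simp: realization_set_def boundary_complex_def)
  then obtain a where "a \<in> A" "a \<notin> \<sigma>" by blast
  then show "x \<in> {x \<in> geom_simplex A. \<exists>a\<in>A. x a = 0}"
    using \<sigma> geom_simplex_mono[of \<sigma> A] assms by (auto simp: geom_simplex_def)
next
  fix x assume "x \<in> {x \<in> geom_simplex A. \<exists>a\<in>A. x a = 0}"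
  then obtain a where "a \<in> A" "x \<in> geom_simplex (A - {a})" using geom_simplex_delete[OF assms] by auto
  then show "x \<in> realization_set (boundary_complex A)"
    using assms by (auto simp: realization_set_def boundary_complex_def intro!: bexI[of _ "A - {a}"])
qed

section \<open>The boundary of a simplex\<close>

text \<open>The differences with coordinate 0 are linear coordinates that send the barycentre to the
  origin; dividing by their norm \<nu> projects the boundary radially to the unit sphere. The norm
  is positive because equal coordinates, one of them zero, cannot sum to 1.\<close>

lemma boundary_simplex_homeomorphic_nsphere:
  fixes A :: "'a set"
  assumes e: "bij_betw e {..Suc d} A"
  shows "realization (boundary_complex A) homeomorphic_space nsphere d"
proof -
  have A: "finite A" using e bij_betw_finite by blast
  define c where "c = inv_into {..Suc d} e"
  have eA: "e i \<in> A" if "i \<le> Suc d" for i using e that by (auto simp: bij_betw_def)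
  have ce: "c (e i) = i" if "i \<le> Suc d" for i
    unfolding c_def using e that by (auto simp: bij_betw_def intro: inv_into_f_f)
  have ec: "e (c v) = v" "c v \<le> Suc d" if "v \<in> A" for v
    using e that f_inv_into_f[of v e "{..Suc d}"] inv_into_into[of v e "{..Suc d}"]
    by (auto simp: c_def bij_betw_def)
  have sum_e: "(\<Sum>i\<le>Suc d. f (e i)) = sum f A" for f :: "'a \<Rightarrow> real"
    by (rule sum.reindex_bij_betw[OF e])
  define R where "R = {x \<in> geom_simplex A. \<exists>a\<in>A. x a = 0}"
  define S where "S = {x::nat \<Rightarrow> real. (\<Sum>i\<le>d. x i ^ 2) = 1 \<and> (\<forall>i>d. x i = 0)}"
  have RX: "realization (boundary_complex A) = top_of_set R"
  proof -
    have "boundary_complex A \<subseteq> Pow A" by (auto simp: boundary_complex_def)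
    then have "finite (boundary_complex A)" using A finite_subset by blast
    then show ?thesis
      using realization_finite[of "boundary_complex A"] realization_set_boundary[OF A] A
      unfolding R_def by (auto simp: boundary_complex_def intro: finite_subset)
  qed
  have SX: "nsphere d = top_of_set S"
    by (simp add: nsphere S_def powertop_real_eq_euclidean)
  define \<nu> where "\<nu> x = sqrt (\<Sum>i\<le>d. (x (e (Suc i)) - x (e 0)) ^ 2)" for x :: "'a \<Rightarrow> real"
  define f where "f x = (\<lambda>i. if i \<le> d then (x (e (Suc i)) - x (e 0)) / \<nu> x else 0)" for x
  \<comment> \<open>The inverse restores coordinate 0 as the value 0, subtracts the minimum \<mu> so
    that the point lands on a facet, and divides by the sum \<open>s\<close>. Hence the index shift
    \<open>i - 1\<close>.\<close>
  define w where "w u i = (if i = 0 then 0 else u (i - 1))" for u :: "nat \<Rightarrow> real" and i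
  define \<mu> where "\<mu> u = Min (w u ` {..Suc d})" for u
  define s where "s u = (\<Sum>i\<le>Suc d. w u i - \<mu> u)" for u
  define g where "g u = (\<lambda>v. if v \<in> A then (w u (c v) - \<mu> u) / s u else 0)" for u
  have \<mu>_le: "\<mu> u \<le> w u i" if "i \<le> Suc d" for u i
    unfolding \<mu>_def using that by (intro Min_le) auto
  have \<mu>_att: "\<exists>i\<le>Suc d. w u i = \<mu> u" for u
  proof -
    have "\<mu> u \<in> w u ` {..Suc d}" unfolding \<mu>_def by (rule Min_in) auto
    then show ?thesis by auto
  qed
  have \<nu>_pos: "0 < \<nu> x" if x: "x \<in> R" for x
  proof (rule ccontr)
    assume "\<not> 0 < \<nu> x"
    then have "(\<Sum>i\<le>d. (x (e (Suc i)) - x (e 0)) ^ 2) = 0"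
      using sum_nonneg[of "{..d}" "\<lambda>i. (x (e (Suc i)) - x (e 0)) ^ 2"] by (simp add: \<nu>_def)
    then have eq: "x (e (Suc i)) = x (e 0)" if "i \<le> d" for i
      using that by (simp add: sum_nonneg_eq_0_iff)
    have const: "x (e i) = x (e 0)" if "i \<le> Suc d" for i
      using eq[of "i - 1"] that by (cases i) auto
    then have "x v = x (e 0)" if "v \<in> A" for v using ec[OF that] by metis
    moreover obtain a where "a \<in> A" "x a = 0" using x by (auto simp: R_def)
    ultimately have "x v = 0" if "v \<in> A" for v using that by metis
    then have "sum x A = 0" by simp
    then show False using x by (auto simp: R_def geom_simplex_def)
  qed
  have s_pos: "0 < s u" if u: "u \<in> S" for u
  proof (rule ccontr)
    assume "\<not> 0 < s u"
    moreover have "0 \<le> s u" unfolding s_def using \<mu>_le by (intro sum_nonneg) auto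
    ultimately have "s u = 0" by simp
    then have eq: "w u i = \<mu> u" if "i \<le> Suc d" for i
      using that \<mu>_le unfolding s_def by (subst (asm) sum_nonneg_eq_0_iff) auto
    have "\<mu> u = 0" using eq[of 0] by (simp add: w_def)
    then have "u i = 0" if "i \<le> d" for i using eq[of "Suc i"] that by (simp add: w_def)
    then have "(\<Sum>i\<le>d. u i ^ 2) = 0" by simp
    then show False using u by (simp add: S_def)
  qed
  have fS: "f x \<in> S" if x: "x \<in> R" for x
  proof -
    have "(\<Sum>i\<le>d. (f x i)\<^sup>2) = (\<Sum>i\<le>d. (x (e (Suc i)) - x (e 0)) ^ 2) / (\<nu> x)\<^sup>2"
      by (simp add: f_def power_divide sum_divide_distrib)
    also have "(\<nu> x)\<^sup>2 = (\<Sum>i\<le>d. (x (e (Suc i)) - x (e 0)) ^ 2)"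
      unfolding \<nu>_def by (intro real_sqrt_pow2 sum_nonneg) auto
    finally have "(\<Sum>i\<le>d. (f x i)\<^sup>2) = 1"
      using \<nu>_pos[OF x] by (simp add: \<nu>_def)
    then show ?thesis by (simp add: S_def f_def)
  qed
  have g_e: "g u (e i) = (w u i - \<mu> u) / s u" if "i \<le> Suc d" for u i
    using that by (simp add: g_def eA ce)
  have gR: "g u \<in> R" if u: "u \<in> S" for u
  proof -
    have "sum (g u) A = (\<Sum>i\<le>Suc d. (w u i - \<mu> u) / s u)"
      unfolding sum_e[symmetric] by (rule sum.cong) (auto simp: g_e)
    also have "\<dots> = 1" using s_pos[OF u] by (simp add: s_def sum_divide_distrib[symmetric])
    finally have "sum (g u) A = 1" .
    moreover obtain i where "i \<le> Suc d" "w u i = \<mu> u" using \<mu>_att by blast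
    then have "g u (e i) = 0" "e i \<in> A" using g_e eA by auto
    moreover have "0 \<le> g u v" for v
      using s_pos[OF u] \<mu>_le ec by (simp add: g_def)
    ultimately show ?thesis by (auto simp: R_def geom_simplex_def g_def)
  qed
  have gf: "g (f x) = x" if x: "x \<in> R" for x
  proof -
    have n: "\<nu> x > 0" by (rule \<nu>_pos[OF x])
    have wf: "w (f x) i = (x (e i) - x (e 0)) / \<nu> x" if "i \<le> Suc d" for i
      using that by (cases i) (auto simp: w_def f_def)
    obtain a where a: "a \<in> A" "x a = 0" using x by (auto simp: R_def)
    have x0: "0 \<le> x v" for v using x by (auto simp: R_def geom_simplex_def)
    \<comment> \<open>The minimum of the differences is attained at a vertex where \<open>x\<close>
      vanishes, which exhibits the subtracted constant.\<close>
    have \<mu>f: "\<mu> (f x) = - x (e 0) / \<nu> x"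
    proof (rule antisym)
      show "\<mu> (f x) \<le> - x (e 0) / \<nu> x"
        using \<mu>_le[OF ec(2)[OF a(1)], of "f x"] wf[OF ec(2)[OF a(1)]] ec(1)[OF a(1)] a(2) by simp
      obtain i where i: "i \<le> Suc d" "w (f x) i = \<mu> (f x)" using \<mu>_att by blast
      have "- x (e 0) / \<nu> x \<le> (x (e i) - x (e 0)) / \<nu> x"
        using n x0 by (intro divide_right_mono) auto
      then show "- x (e 0) / \<nu> x \<le> \<mu> (f x)" using wf[OF i(1)] i(2) by simp
    qed
    have diff: "w (f x) i - \<mu> (f x) = x (e i) / \<nu> x" if "i \<le> Suc d" for i
      unfolding wf[OF that] \<mu>f by (simp add: diff_divide_distrib)
    have "s (f x) = (\<Sum>i\<le>Suc d. x (e i) / \<nu> x)"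
      unfolding s_def by (rule sum.cong) (auto simp: diff)
    also have "\<dots> = sum x A / \<nu> x" by (simp only: sum_divide_distrib[symmetric] sum_e)
    also have "\<dots> = 1 / \<nu> x" using x by (auto simp: R_def geom_simplex_def)
    finally have sf: "s (f x) = 1 / \<nu> x" .
    show ?thesis
    proof
      fix v
      show "g (f x) v = x v"
        using diff[OF ec(2)] ec(1) sf n x by (cases "v \<in> A") (auto simp: g_def R_def geom_simplex_def)
    qed
  qed
  have fg: "f (g u) = u" if u: "u \<in> S" for u
  proof -
    have sp: "s u > 0" by (rule s_pos[OF u])
    have diff: "g u (e (Suc i)) - g u (e 0) = u i / s u" if "i \<le> d" for i
      using that by (simp add: g_e w_def diff_divide_distrib)
    have "\<nu> (g u) = sqrt (\<Sum>i\<le>d. (u i / s u) ^ 2)"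
      unfolding \<nu>_def by (simp add: diff)
    also have "(\<Sum>i\<le>d. (u i / s u) ^ 2) = (1 / s u)\<^sup>2"
      using u by (simp add: power_divide sum_divide_distrib[symmetric] S_def)
    finally have "\<nu> (g u) = 1 / s u" using sp by simp
    then show ?thesis using sp u by (auto simp: f_def diff S_def fun_eq_iff)
  qed
  have coord: "continuous_on T (\<lambda>x. x v)" for T :: "('b \<Rightarrow> real) set" and v
    by (rule continuous_on_subset[OF continuous_on_product_coordinates]) auto
  have "continuous_on R f"
  proof (rule continuous_on_coordinatewise_then_product)
    fix i
    have c\<nu>: "continuous_on R \<nu>" unfolding \<nu>_def by (intro continuous_intros coord)
    show "continuous_on R (\<lambda>x. f x i)"
    proof (cases "i \<le> d")
      case True
      have "\<forall>x\<in>R. \<nu> x \<noteq> 0" using \<nu>_pos by force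
      then show ?thesis unfolding f_def using True by (simp add: continuous_intros coord c\<nu>)
    qed (simp add: f_def)
  qed
  moreover have "continuous_on S g"
  proof (rule continuous_on_coordinatewise_then_product)
    fix v
    have cw: "continuous_on S (\<lambda>u. w u i)" for i
      by (cases "i = 0") (simp_all add: w_def coord)
    have "continuous_on S w"
      by (rule continuous_on_coordinatewise_then_product) (rule cw)
    then have "continuous_on S ((\<lambda>y. Min (y ` {..Suc d})) \<circ> w)"
      by (rule continuous_on_compose) (rule continuous_on_Min_coords, auto)
    then have c\<mu>: "continuous_on S \<mu>" by (simp add: \<mu>_def o_def)
    have cs: "continuous_on S s" unfolding s_def by (intro continuous_intros cw c\<mu>)
    have "\<forall>u\<in>S. s u \<noteq> 0" using s_pos by force
    then show "continuous_on S (\<lambda>u. g u v)"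
      unfolding g_def by (cases "v \<in> A") (simp_all add: continuous_intros cw c\<mu> cs)
  qed
  ultimately have "homeomorphic_maps (top_of_set R) (top_of_set S) f g"
    using fS gR fg gf unfolding homeomorphic_maps_def by auto
  then show ?thesis unfolding RX SX homeomorphic_space_def by blast
qed

text \<open>If \<open>k\<close> is inverse to \<open>g \<circ> f\<close>, then
  \<open>f \<circ> k\<close> is inverse to \<open>g\<close>. One composite is given; for the other,
  \<open>f \<circ> f'\<close> is inserted on the right, so that \<open>k \<circ> g \<circ> f\<close>
  appears and cancels.\<close>

lemma homotopy_equivalence_map_factor:
  assumes f: "homotopy_equivalence_map X Y f" and gf: "homotopy_equivalence_map X Z (g \<circ> f)"
    and g: "continuous_map Y Z g"
  shows "homotopy_equivalence_map Y Z g"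
proof -
  let ?H = "homotopic_with (\<lambda>x. True)"
  obtain f' where f': "continuous_map X Y f" "continuous_map Y X f'"
    "?H X X (f' \<circ> f) id" "?H Y Y (f \<circ> f') id"
    using f by (auto simp: homotopy_equivalence_map_def)
  obtain k where k: "continuous_map Z X k" "?H X X (k \<circ> (g \<circ> f)) id" "?H Z Z ((g \<circ> f) \<circ> k) id"
    using gf by (auto simp: homotopy_equivalence_map_def)
  have fkg: "continuous_map Y Y (f \<circ> k \<circ> g)"
    using continuous_map_compose[OF g continuous_map_compose[OF k(1) f'(1)]] by (simp add: o_assoc)
  have "?H Y Y ((f \<circ> k \<circ> g) \<circ> (f \<circ> f')) ((f \<circ> k \<circ> g) \<circ> id)"
    by (rule homotopic_with_compose_continuous_map_left[OF f'(4) fkg]) auto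
  then have 1: "?H Y Y (f \<circ> k \<circ> g) ((f \<circ> k \<circ> g) \<circ> (f \<circ> f'))"
    using homotopic_with_symD by (metis comp_id)
  have "?H X Y (f \<circ> (k \<circ> (g \<circ> f))) (f \<circ> id)"
    by (rule homotopic_with_compose_continuous_map_left[OF k(2) f'(1)]) auto
  then have "?H Y Y (f \<circ> (k \<circ> (g \<circ> f)) \<circ> f') (f \<circ> id \<circ> f')"
    by (rule homotopic_with_compose_continuous_map_right[OF _ f'(2)]) auto
  then have 2: "?H Y Y ((f \<circ> k \<circ> g) \<circ> (f \<circ> f')) (f \<circ> f')"
    by (simp add: o_assoc)
  have "?H Y Y (f \<circ> k \<circ> g) id"
    using homotopic_with_trans[OF homotopic_with_trans[OF 1 2] f'(4)] .
  then show ?thesis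
    unfolding homotopy_equivalence_map_def
    using g continuous_map_compose[OF k(1) f'(1)] k(3) by (intro conjI exI[of _ "f \<circ> k"]) (auto simp: o_assoc)
qed

section \<open>Conclusion: the homotopy type of arc covers and the range of radii\<close>

lemma arc_cover_homotopy_equivalent_nsphere:
  assumes "0 < \<epsilon>" "real (2 * l + 3) * \<epsilon> < 1"
  shows "realization (arc_cover_complex (l + 1) \<epsilon>) homotopy_equivalent_space nsphere (2 * l + 1)"
proof -
  let ?m = "2 * (l + 1) + 1"
  have "bij_betw (\<lambda>j. real j / real ?m) {..Suc (2 * l + 1)} (grid ?m)"
    by (auto simp: bij_betw_def inj_on_def grid_def lessThan_Suc_atMost)
  then have "realization (boundary_complex (grid ?m)) homotopy_equivalent_space nsphere (2 * l + 1)"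
    by (intro homeomorphic_imp_homotopy_equivalent_space boundary_simplex_homeomorphic_nsphere)
  moreover have "realization (boundary_complex (grid ?m)) homotopy_equivalent_space realization (cell_complex ?m)"
    by (rule homotopy_equivalence_map_imp_space[OF homotopy_equivalence_boundary_cell]) simp
  moreover have "realization (arc_cover_complex (l + 1) \<epsilon>) homotopy_equivalent_space realization (cell_complex ?m)"
    by (rule homotopy_equivalence_map_imp_space[OF homotopy_equivalence_arc_cover_cell])
       (use assms in \<open>auto simp: algebra_simps\<close>)
  ultimately show ?thesis
    by (meson homotopy_equivalent_space_sym homotopy_eqv_trans)
qed

theorem theorem9p8:
  fixes r :: real and l :: nat
  assumes "0 < r" and "r < 1/2"
    and "real l / (2 * (real l + 1)) < r" and "r \<le> (real l + 1) / (2 * (real l + 2))"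
  shows "realization (cech_complex circle r) homotopy_equivalent_space nsphere (2 * l + 1) \<and>
    (\<forall>r'. r \<le> r' \<and> r' \<le> (real l + 1) / (2 * (real l + 2)) \<longrightarrow>
           homotopy_equivalence_map (realization (cech_complex circle r))
             (realization (cech_complex circle r')) id)"
proof -
  define n where "n = l + 1"
  define s where "s = 1 - 2 * r"
  \<comment> \<open>The first bound gives \<open>real (2 * l + 3) * \<epsilon> < 1\<close> for the
    cells, and also \<epsilon> \<le> 1 / (l + 2), which is at most \<open>1 - 2 * \<rho>\<close> for
    every admissible radius. The second spends half of the room in \<open>s < 1 / real n\<close>.
    Larger radii only decrease the gap length, so one \<epsilon> serves all of them.\<close>
  define \<epsilon> where "\<epsilon> = min (1 / (2 * real l + 4)) ((1 / real n - s) / 2)"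
  have "real n * s < 1"
    using assms(3) by (simp add: n_def s_def field_simps)
  then have sn: "s < 1 / real n" by (simp add: n_def field_simps)
  then have \<epsilon>0: "0 < \<epsilon>" by (simp add: \<epsilon>_def)
  have "\<epsilon> \<le> (1 / real n - s) / 2" unfolding \<epsilon>_def by (rule min.cobounded2)
  then have "\<epsilon> + \<epsilon> \<le> 1 / real n - s" by (simp add: pos_le_divide_eq)
  then have "s + \<epsilon> < 1 / real n" using sn \<epsilon>0 by linarith
  then have ns: "real n * (s + \<epsilon>) < 1" by (simp add: n_def field_simps)
  have "\<epsilon> \<le> 1 / (2 * real l + 4)" unfolding \<epsilon>_def by (rule min.cobounded1)
  then have \<epsilon>m: "real (2 * l + 3) * \<epsilon> < 1" "\<epsilon> \<le> 1 / (real l + 2)"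
    using \<epsilon>0 by (auto simp: field_simps)
  have he: "homotopy_equivalence_map (realization (arc_cover_complex n \<epsilon>)) (realization (cech_complex circle \<rho>)) id"
    if \<rho>: "r \<le> \<rho>" "\<rho> \<le> (real l + 1) / (2 * (real l + 2))" for \<rho>
  proof -
    have r2: "\<rho> < 1/2"
    proof -
      have "(real l + 1) / (2 * (real l + 2)) < 1/2" by (simp add: field_simps)
      then show ?thesis using \<rho> by linarith
    qed
    have low: "1 \<le> (real n + 1) * (1 - 2 * \<rho>)"
      using \<rho>(2) by (simp add: n_def field_simps)
    then have "1 / (real l + 2) \<le> 1 - 2 * \<rho>" by (simp add: n_def field_simps)
    then have "\<epsilon> \<le> 1 - 2 * \<rho>" using \<epsilon>m by linarith
    moreover have "real n * (1 - 2 * \<rho> + \<epsilon>) \<le> real n * (s + \<epsilon>)"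
      using \<rho> by (intro mult_left_mono) (auto simp: s_def)
    then have "real n * (1 - 2 * \<rho> + \<epsilon>) < 1" using ns by linarith
    ultimately have "homotopy_equivalence_map (realization (arc_cover_complex n \<epsilon>)) (realization (gap_complex (1 - 2 * \<rho>))) id"
      using low r2 \<epsilon>0 by (intro homotopy_equivalence_arc_cover_gap) (auto simp: n_def)
    then show ?thesis
      using cech_complex_eq_gap_complex[of \<rho>] assms(1) \<rho> r2 by simp
  qed
  have "realization (cech_complex circle r) homotopy_equivalent_space nsphere (2 * l + 1)"
    using homotopy_equivalence_map_imp_space[OF he[OF order_refl assms(4)]]
      arc_cover_homotopy_equivalent_nsphere[OF \<epsilon>0 \<epsilon>m(1)] unfolding n_def
    by (meson homotopy_equivalent_space_sym homotopy_eqv_trans)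
  moreover have "homotopy_equivalence_map (realization (cech_complex circle r))
             (realization (cech_complex circle r')) id"
    if r': "r \<le> r'" "r' \<le> (real l + 1) / (2 * (real l + 2))" for r'
  proof (rule homotopy_equivalence_map_factor)
    show "homotopy_equivalence_map (realization (arc_cover_complex n \<epsilon>)) (realization (cech_complex circle r)) id"
      by (rule he[OF order_refl assms(4)])
    show "homotopy_equivalence_map (realization (arc_cover_complex n \<epsilon>)) (realization (cech_complex circle r')) (id \<circ> id)"
      using he[OF r'] by simp
    have "circle_ball x r \<subseteq> circle_ball x r'" for x
      using r' by (auto simp: circle_ball_def)
    note ball = this
    have "cech_complex circle r \<subseteq> cech_complex circle r'"
    proof
      fix \<sigma> assume "\<sigma> \<in> cech_complex circle r"
      then have \<sigma>: "\<sigma> \<subseteq> circle" "finite \<sigma>" and "(\<Inter>x\<in>\<sigma>. circle_ball x r) \<inter> circle \<noteq> {}"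
        by (simp_all add: cech_complex_def)
      then obtain z where "z \<in> (\<Inter>x\<in>\<sigma>. circle_ball x r) \<inter> circle" by blast
      then have "z \<in> (\<Inter>x\<in>\<sigma>. circle_ball x r') \<inter> circle" using ball by blast
      with \<sigma> show "\<sigma> \<in> cech_complex circle r'" by (auto simp: cech_complex_def)
    qed
    then show "continuous_map (realization (cech_complex circle r)) (realization (cech_complex circle r')) id"
      by (rule continuous_map_realization_mono)
  qed
  ultimately show ?thesis by blast
qed

end
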